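(* Let $d\ge 1$ and let $I$ be any zero dimensional ideal in $\mathcal{A}_d=\mathbb{C}[z_1,\dots,z_d]$. Then $I$ has the stable division property with respect to the $H^2$ norm.
   Context: The $H^2$ norm on $\mathcal{A}_d$ is the norm of the inner product for which distinct monomials are orthogonal and $\|z^\alpha\|^2=\frac{\alpha_1!\cdots\alpha_d!}{|\alpha|!}$. An ideal $I\subseteq\mathcal{A}_d$ is zero dimensional if its affine variety $V(I)=\{z\in\mathbb{C}^d: f(z)=0\ \text{for all } f\in I\}$ is finite. An ideal $I\subseteq\mathcal{A}_d$ has the stable division property (with respect to a norm $\|\cdot\|$) if there are a finite set $\{f_1,\dots,f_k\}\subset I$ generating $I$ and a constant $C$ such that every $h\in I$ can be written $h=a_1f_1+\dots+a_kf_k$ with $a_i\in\mathcal{A}_d$ and $\sum_i\|a_if_i\|^2\le C\|h\|^2$. *)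

theory Defs
  imports "HOL-Analysis.Analysis" "HOL-Library.Poly_Mapping"
begin

text \<open>
  The ring of complex polynomials in the variables \<open>z\<^sub>i\<close>, with \<open>i\<close> ranging over the finite type
  \<open>'n\<close>, so \<open>d = CARD('n)\<close>. A multi-index is a function \<open>'n \<Rightarrow>\<^sub>0 nat\<close>, a polynomial is the
  finitely supported family of its coefficients, and multiplication is the
  convolution product.
\<close>

type_synonym 'n mpoly = "('n \<Rightarrow>\<^sub>0 nat) \<Rightarrow>\<^sub>0 complex"

definition eval_mpoly :: "'n::finite mpoly \<Rightarrow> complex ^ 'n \<Rightarrow> complex" where
  "eval_mpoly p z =
     (\<Sum>\<alpha>\<in>Poly_Mapping.keys p. Poly_Mapping.lookup p \<alpha> * (\<Prod>i\<in>UNIV. (z $ i) ^ Poly_Mapping.lookup \<alpha> i))"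

text \<open>
  The ideals of a commutative ring are its submodules when it is regarded as a module over
  itself. The locale is not interpreted globally, since its simp rule \<open>scale_scale\<close> would
  then reassociate products; facts about ideals are available as \<open>module.subspace_def [OF module_times]\<close>
  and the like.
\<close>

lemma module_times: "module ((*) :: 'a::comm_ring_1 \<Rightarrow> 'a \<Rightarrow> 'a)"
  by unfold_locales (simp_all add: algebra_simps)

abbreviation is_ideal :: "'a::comm_ring_1 set \<Rightarrow> bool" where
  "is_ideal \<equiv> module.subspace (*)"

abbreviation ideal_generated :: "'a::comm_ring_1 set \<Rightarrow> 'a set" where
  "ideal_generated \<equiv> module.span (*)"

definition affine_variety :: "'n::finite mpoly set \<Rightarrow> (complex ^ 'n) set" where
  "affine_variety I = {z. \<forall>f\<in>I. eval_mpoly f z = 0}"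

definition zero_dimensional :: "'n::finite mpoly set \<Rightarrow> bool" where
  "zero_dimensional I \<longleftrightarrow> finite (affine_variety I)"

definition h2_weight :: "('n::finite \<Rightarrow>\<^sub>0 nat) \<Rightarrow> real" where
  "h2_weight \<alpha> = (\<Prod>i\<in>UNIV. fact (Poly_Mapping.lookup \<alpha> i)) / fact (\<Sum>i\<in>UNIV. Poly_Mapping.lookup \<alpha> i)"

definition h2_inner :: "'n::finite mpoly \<Rightarrow> 'n mpoly \<Rightarrow> complex" where
  "h2_inner p q =
     (\<Sum>\<alpha>\<in>Poly_Mapping.keys p \<inter> Poly_Mapping.keys q.
        Poly_Mapping.lookup p \<alpha> * cnj (Poly_Mapping.lookup q \<alpha>) * of_real (h2_weight \<alpha>))"

definition h2_norm :: "'n::finite mpoly \<Rightarrow> real" where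
  "h2_norm p = sqrt (Re (h2_inner p p))"

text \<open>
  \<^const>\<open>h2_inner\<close> is the sesquilinear form with the prescribed values on monomials, and it is
  positive definite.
\<close>

lemma h2_inner_superset:
  assumes "finite A" "Poly_Mapping.keys p \<inter> Poly_Mapping.keys q \<subseteq> A"
  shows "h2_inner p q = (\<Sum>\<alpha>\<in>A. Poly_Mapping.lookup p \<alpha> * cnj (Poly_Mapping.lookup q \<alpha>) * of_real (h2_weight \<alpha>))"
  unfolding h2_inner_def
  by (rule sum.mono_neutral_left) (use assms in \<open>auto simp: in_keys_iff\<close>)

lemma h2_inner_monomial:
  "h2_inner (Poly_Mapping.single \<alpha> 1) (Poly_Mapping.single \<beta> 1) =
     (if \<alpha> = \<beta> then of_real (h2_weight \<alpha>) else 0)"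
  by (auto simp: h2_inner_def)

lemma h2_inner_add_left: "h2_inner (p + q) r = h2_inner p r + h2_inner q r"
  by (simp add: h2_inner_superset[of "Poly_Mapping.keys r"] lookup_add algebra_simps sum.distrib)

lemma h2_inner_scale_left:
  "h2_inner (Poly_Mapping.single 0 c * p) q = c * h2_inner p q"
proof -
  have "Poly_Mapping.lookup (Poly_Mapping.single 0 c * p) \<alpha> = c * Poly_Mapping.lookup p \<alpha>" for \<alpha>
    by (simp add: Poly_Mapping.map.rep_eq when_def flip: mult_map_scale_conv_mult)
  then show ?thesis
    by (simp add: h2_inner_superset[of "Poly_Mapping.keys q"] sum_distrib_left algebra_simps)
qed

lemma h2_inner_cnj: "cnj (h2_inner p q) = h2_inner q p"
  by (simp add: h2_inner_def Int_commute mult.commute)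

lemma h2_weight_pos: "h2_weight \<alpha> > 0"
  by (simp add: h2_weight_def prod_pos)

lemma h2_inner_self:
  "h2_inner p p = of_real (\<Sum>\<alpha>\<in>Poly_Mapping.keys p. (cmod (Poly_Mapping.lookup p \<alpha>))\<^sup>2 * h2_weight \<alpha>)"
  by (simp add: h2_inner_def complex_norm_square del: of_real_power flip: of_real_power)

lemma h2_inner_pos: "p \<noteq> 0 \<Longrightarrow> Re (h2_inner p p) > 0"
  unfolding h2_inner_self Re_complex_of_real
  by (intro sum_pos mult_pos_pos) (auto simp: h2_weight_pos in_keys_iff keys_eq_empty)

definition stable_division_property ::
  "('n::finite mpoly \<Rightarrow> real) \<Rightarrow> 'n mpoly set \<Rightarrow> bool" where
  "stable_division_property N I \<longleftrightarrow>
     (\<exists>F C. finite F \<and> F \<subseteq> I \<and> ideal_generated F = I \<and>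
        (\<forall>h\<in>I. \<exists>a. h = (\<Sum>f\<in>F. a f * f) \<and> (\<Sum>f\<in>F. (N (a f * f))\<^sup>2) \<le> C * (N h)\<^sup>2))"

end

theory Submission
  imports Defs "HOL-Computational_Algebra.Fundamental_Theorem_Algebra"
begin

text \<open>
  If \<open>s + t = 1\<close> with \<open>t I\<^sub>1 \<subseteq> I\<close> and \<open>s I\<^sub>2 \<subseteq> I\<close>, then \<open>h = t h + s h\<close> transports stable divisions in
  \<open>I\<^sub>1\<close> and \<open>I\<^sub>2\<close> to one in \<open>I\<close>, because multiplication by a polynomial is bounded. By the
  Nullstellensatz this reduces the theorem to ideals with a single zero, and by invariance of the
  \<open>H\<^sup>2\<close> norm under unitary substitutions the zero may be taken to be \<open>r e\<^sub>a\<close>. Then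
  \<open>z\<^sub>j\<^sup>k\<close> for \<open>j \<noteq> a\<close> and \<open>(z\<^sub>a - r)\<^sup>k\<close> lie in \<open>I\<close>. The part of \<open>h\<close> divisible by some \<open>z\<^sub>j\<^sup>k\<close> splits off
  orthogonally, and the rest is \<open>v + (z\<^sub>a - r)\<^sup>k q\<close> with \<open>v\<close> in a finite-dimensional subspace of \<open>I\<close>.

  If \<open>\<bar>r\<bar> < 1\<close>, then \<open>v\<close> depends boundedly on \<open>h\<close>. If \<open>\<bar>r\<bar> \<ge> 1\<close> it does not, but \<open>v\<close> can be replaced by
  \<open>A v\<close> for a polynomial \<open>A \<equiv> 1\<close> modulo \<open>(z\<^sub>a - r)\<^sup>k\<close> that makes \<open>A v\<close> arbitrarily small: for \<open>k = 1\<close> take the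
  mean of \<open>1, z\<^sub>a/r, \<dots>, (z\<^sub>a/r)\<^sup>n\<^sup>-\<^sup>1\<close>, as in the mean ergodic theorem.
\<close>

section \<open>Polynomials and their \<open>H\<^sup>2\<close> norm\<close>

text \<open>Only the terms \<open>a f * f\<close> are estimated, never the cofactors
  \<open>a f\<close>. Hence one generator comes free of charge: once all other terms are bounded by
  multiples of the norm of \<open>h\<close>, the remaining term is \<open>h\<close> minus their sum.
  The generator \<open>(Var a - Cst r) ^ k\<close> has this role, so \<open>v\<close> may be altered
  by any multiple of it, and the multiplier \<open>A\<close> may even depend on \<open>h\<close>:
  only the generators and the constant have to be uniform. For |r| >= 1 this freedom is essential,
  because the values and derivatives at z_a = r that determine \<open>v\<close> are then unbounded
  functionals in the H^2 norm. For |r| < 1 they are bounded, because the weight of z_a^n z^beta with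
  beta fixed decays only polynomially in n and so dominates, up to a constant, every decaying
  geometric sequence. The axis position matters because division by the powers of the other
  variables becomes a mere sorting of monomials, which leaves a single variable to be treated
  analytically.\<close>

abbreviation coef :: "('a \<Rightarrow>\<^sub>0 'b::zero) \<Rightarrow> 'a \<Rightarrow> 'b" where
  "coef \<equiv> Poly_Mapping.lookup"

abbreviation supp :: "('a \<Rightarrow>\<^sub>0 'b::zero) \<Rightarrow> 'a set" where
  "supp \<equiv> Poly_Mapping.keys"

abbreviation unit_idx :: "'n \<Rightarrow> 'n \<Rightarrow>\<^sub>0 nat" where
  "unit_idx i \<equiv> Poly_Mapping.single i (Suc 0)"

definition monom_of :: "('n \<Rightarrow>\<^sub>0 nat) \<Rightarrow> 'n mpoly" where
  "monom_of \<alpha> = Poly_Mapping.single \<alpha> 1"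

definition Cst :: "complex \<Rightarrow> 'n mpoly" where
  "Cst c = Poly_Mapping.single 0 c"

definition Var :: "'n \<Rightarrow> 'n mpoly" where
  "Var i = monom_of (unit_idx i)"

lemma Cst_0 [simp]: "Cst 0 = 0"
  and Cst_1 [simp]: "Cst 1 = 1"
  by (simp_all add: Cst_def)

lemma Cst_add: "Cst (a + b) = Cst a + Cst b"
  by (simp add: Cst_def single_add)

lemma Cst_diff: "Cst (a - b) = Cst a - Cst b"
  by (simp add: Cst_def single_diff)

lemma Cst_mult: "Cst (a * b) = Cst a * Cst b"
  by (simp add: Cst_def mult_single)

lemma Cst_power: "Cst (a ^ n) = Cst a ^ n"
  by (induction n) (simp_all add: Cst_mult)

lemma Cst_sum: "Cst (sum f A) = (\<Sum>x\<in>A. Cst (f x))"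
  by (induction A rule: infinite_finite_induct) (simp_all add: Cst_add)

lemma monom_of_0 [simp]: "monom_of 0 = 1"
  by (simp add: monom_of_def)

lemma monom_of_add: "monom_of (\<alpha> + \<beta>) = monom_of \<alpha> * monom_of \<beta>"
  by (simp add: monom_of_def mult_single)

lemma Cst_mult_monom_of: "Cst c * monom_of \<alpha> = Poly_Mapping.single \<alpha> c"
  by (simp add: Cst_def monom_of_def mult_single)

lemma Var_power: "Var i ^ n = monom_of (Poly_Mapping.single i n)"
  by (induction n) (simp_all add: Var_def flip: monom_of_add single_add)

lemma mpoly_sum_monom_of: "p = (\<Sum>\<alpha>\<in>supp p. Cst (coef p \<alpha>) * monom_of \<alpha>)"
proof (rule poly_mapping_eqI)
  fix \<beta>
  have "(\<Sum>\<alpha>\<in>supp p. coef (Poly_Mapping.single \<alpha> (coef p \<alpha>)) \<beta>) = coef p \<beta>"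
    by (simp add: lookup_single when_def in_keys_iff)
  then show "coef p \<beta> = coef (\<Sum>\<alpha>\<in>supp p. Cst (coef p \<alpha>) * monom_of \<alpha>) \<beta>"
    by (simp add: Cst_mult_monom_of lookup_sum)
qed

lemma mpoly_monom_induct [case_names zero monom add]:
  assumes "P 0" "\<And>\<alpha> c. P (Cst c * monom_of \<alpha>)" "\<And>p q. P p \<Longrightarrow> P q \<Longrightarrow> P (p + q)"
  shows "P p"
proof -
  have "P (\<Sum>\<alpha>\<in>A. Cst (coef p \<alpha>) * monom_of \<alpha>)" if "finite A" for A
    using that by induction (auto intro: assms)
  then show ?thesis
    using mpoly_sum_monom_of[of p] by (metis finite_keys)
qed

lemma multi_index_induct [case_names zero unit]:
  fixes \<alpha> :: "'n::finite \<Rightarrow>\<^sub>0 nat"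
  assumes "P 0" "\<And>i \<alpha>. P \<alpha> \<Longrightarrow> P (unit_idx i + \<alpha>)"
  shows "P \<alpha>"
proof (induction "\<Sum>i\<in>UNIV. coef \<alpha> i" arbitrary: \<alpha>)
  case 0
  then have "\<alpha> = 0" by (intro poly_mapping_eqI) simp
  then show ?case using assms(1) by simp
next
  case (Suc n)
  then have "\<exists>i. coef \<alpha> i \<noteq> 0"
    by (metis nat.distinct(1) sum.neutral)
  then obtain i where i: "coef \<alpha> i \<noteq> 0" by blast
  define \<beta> where "\<beta> = \<alpha> - unit_idx i"
  have \<alpha>: "\<alpha> = unit_idx i + \<beta>"
    using i by (intro poly_mapping_eqI) (auto simp: \<beta>_def lookup_add lookup_minus lookup_single when_def)
  have "(\<Sum>i\<in>UNIV. coef \<alpha> i) = Suc (\<Sum>i\<in>UNIV. coef \<beta> i)"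
    unfolding \<alpha> by (simp add: lookup_add sum.distrib lookup_single when_def)
  then have "P \<beta>" using Suc by auto
  then show ?case
    unfolding \<alpha> by (rule assms(2))
qed

text \<open>Suited to maps that are understood on constants, on sums and under multiplication by one
  variable.\<close>

lemma mpoly_induct [case_names Cst Var add]:
  fixes p :: "'n::finite mpoly"
  assumes "\<And>c. P (Cst c)" "\<And>i p. P p \<Longrightarrow> P (Var i * p)" "\<And>p q. P p \<Longrightarrow> P q \<Longrightarrow> P (p + q)"
  shows "P p"
proof (induction p rule: mpoly_monom_induct)
  case zero
  show ?case using assms(1)[of 0] by simp
next
  case (monom \<alpha> c)
  show ?case
  proof (induction \<alpha> rule: multi_index_induct)
    case zero
    show ?case using assms(1) by simp
  next
    case (unit i \<alpha>)
    then show ?case using assms(2)[of "Cst c * monom_of \<alpha>" i] by (simp add: Var_def monom_of_add mult.left_commute)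
  qed
qed (rule assms(3))

lemma coef_Cst: "coef (Cst c) \<alpha> = (if \<alpha> = 0 then c else 0)"
  by (auto simp: Cst_def lookup_single when_def)

lemma coef_monom_of: "coef (monom_of \<beta>) \<alpha> = (if \<alpha> = \<beta> then 1 else 0)"
  by (auto simp: monom_of_def lookup_single when_def)

lemma coef_Cst_mult [simp]: "coef (Cst c * p) \<alpha> = c * coef p \<alpha>"
  by (simp add: Cst_def Poly_Mapping.map.rep_eq when_def flip: mult_map_scale_conv_mult)

lemma coef_monom_of_mult_add: "coef (monom_of \<beta> * p) (\<beta> + \<alpha>) = coef p \<alpha>"
proof (induction p rule: mpoly_monom_induct)
  case (monom \<gamma> c)
  have "monom_of \<beta> * (Cst c * monom_of \<gamma>) = Cst c * monom_of (\<beta> + \<gamma>)"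
    by (simp add: monom_of_add algebra_simps)
  then show ?case by (simp add: coef_monom_of)
qed (simp_all add: algebra_simps lookup_add)

lemma coef_monom_of_mult_eq_0:
  assumes "\<And>\<gamma>. \<alpha> \<noteq> \<beta> + \<gamma>"
  shows "coef (monom_of \<beta> * p) \<alpha> = 0"
proof (induction p rule: mpoly_monom_induct)
  case (monom \<gamma> c)
  have "monom_of \<beta> * (Cst c * monom_of \<gamma>) = Cst c * monom_of (\<beta> + \<gamma>)"
    by (simp add: monom_of_add algebra_simps)
  then show ?case using assms by (simp add: coef_monom_of)
qed (simp_all add: algebra_simps lookup_add)

lemma multi_index_split:
  fixes \<alpha> :: "'n \<Rightarrow>\<^sub>0 nat"
  assumes "k \<le> coef \<alpha> i"
  obtains \<gamma> where "\<alpha> = Poly_Mapping.single i k + \<gamma>"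
proof
  show "\<alpha> = Poly_Mapping.single i k + (\<alpha> - Poly_Mapping.single i k)"
    using assms by (intro poly_mapping_eqI) (auto simp: lookup_add lookup_minus lookup_single when_def)
qed

lemma coef_Var_power_mult:
  "coef (Var i ^ k * p) \<alpha> = (if k \<le> coef \<alpha> i then coef p (\<alpha> - Poly_Mapping.single i k) else 0)"
proof (cases "k \<le> coef \<alpha> i")
  case True
  then obtain \<gamma> where \<gamma>: "\<alpha> = Poly_Mapping.single i k + \<gamma>" by (rule multi_index_split)
  show ?thesis
    unfolding Var_power using True by (simp add: \<gamma> coef_monom_of_mult_add)
next
  case False
  then have "\<alpha> \<noteq> Poly_Mapping.single i k + \<gamma>" for \<gamma>
    by (auto simp: lookup_add)
  then show ?thesis
    unfolding Var_power using False by (simp add: coef_monom_of_mult_eq_0)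
qed

lemma coef_Var_mult:
  "coef (Var i * p) \<alpha> = (if coef \<alpha> i = 0 then 0 else coef p (\<alpha> - unit_idx i))"
  using coef_Var_power_mult[of i 1 p \<alpha>] by (auto simp: Suc_le_eq)

lemma supp_Var_mult: "supp (Var i * p) = (\<lambda>\<alpha>. unit_idx i + \<alpha>) ` supp p"
proof (intro equalityI subsetI)
  fix \<alpha> assume "\<alpha> \<in> supp (Var i * p)"
  then have *: "coef \<alpha> i \<noteq> 0" "coef p (\<alpha> - unit_idx i) \<noteq> 0"
    by (auto simp: in_keys_iff coef_Var_mult split: if_splits)
  then obtain \<gamma> where \<gamma>: "\<alpha> = unit_idx i + \<gamma>"
    by (metis Suc_leI multi_index_split neq0_conv)
  then show "\<alpha> \<in> (\<lambda>\<alpha>. unit_idx i + \<alpha>) ` supp p"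
    using * by (auto simp: in_keys_iff)
qed (auto simp: in_keys_iff coef_Var_mult lookup_add)

section \<open>The norm: triangle inequality, contractive variables, bounded multiplication\<close>

lemma h2_norm_superset:
  assumes "finite A" "supp p \<subseteq> A"
  shows "h2_norm p = L2_set (\<lambda>\<alpha>. cmod (coef p \<alpha>) * sqrt (h2_weight \<alpha>)) A"
proof -
  have "h2_norm p = sqrt (\<Sum>\<alpha>\<in>supp p. (cmod (coef p \<alpha>))\<^sup>2 * h2_weight \<alpha>)"
    by (simp add: h2_norm_def h2_inner_self)
  also have "(\<Sum>\<alpha>\<in>supp p. (cmod (coef p \<alpha>))\<^sup>2 * h2_weight \<alpha>) = (\<Sum>\<alpha>\<in>A. (cmod (coef p \<alpha>))\<^sup>2 * h2_weight \<alpha>)"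
    by (rule sum.mono_neutral_left) (use assms in \<open>auto simp: in_keys_iff\<close>)
  finally show ?thesis
    by (simp add: L2_set_def power_mult_distrib h2_weight_pos less_imp_le)
qed

lemma h2_norm_nonneg [simp]: "0 \<le> h2_norm p"
  by (simp add: h2_norm_superset[OF finite_keys order_refl])

lemma h2_norm_0 [simp]: "h2_norm 0 = 0"
  by (simp add: h2_norm_superset[of "{}"])

lemma h2_norm_eq_0_iff: "h2_norm p = 0 \<longleftrightarrow> p = 0"
proof
  assume "h2_norm p = 0"
  then have "\<not> Re (h2_inner p p) > 0"
    by (metis h2_norm_def less_irrefl real_sqrt_gt_zero)
  then show "p = 0" using h2_inner_pos by blast
qed simp

lemma h2_norm_mono:
  assumes "\<And>\<alpha>. cmod (coef p \<alpha>) \<le> cmod (coef q \<alpha>)"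
  shows "h2_norm p \<le> h2_norm q"
proof -
  have "supp p \<subseteq> supp q"
    using assms by (auto simp: in_keys_iff) (metis norm_le_zero_iff norm_zero)
  then show ?thesis
    by (auto simp: h2_norm_superset[of "supp q"] h2_weight_pos less_imp_le intro!: L2_set_mono mult_right_mono assms)
qed

lemma h2_norm_triangle: "h2_norm (p + q) \<le> h2_norm p + h2_norm q"
proof -
  let ?A = "supp p \<union> supp q"
  have "h2_norm (p + q) \<le> L2_set (\<lambda>\<alpha>. cmod (coef p \<alpha>) * sqrt (h2_weight \<alpha>) + cmod (coef q \<alpha>) * sqrt (h2_weight \<alpha>)) ?A"
    by (subst h2_norm_superset[of ?A])
       (auto intro!: L2_set_mono mult_right_mono norm_triangle_ineq
          simp: keys_add h2_weight_pos less_imp_le lookup_add simp flip: distrib_right)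
  also have "\<dots> \<le> h2_norm p + h2_norm q"
    by (simp add: h2_norm_superset[of ?A p] h2_norm_superset[of ?A q] L2_set_triangle_ineq)
  finally show ?thesis .
qed

lemma h2_norm_Cst_mult: "h2_norm (Cst c * p) = cmod c * h2_norm p"
proof -
  have "supp (Cst c * p) \<subseteq> supp p" by (auto simp: in_keys_iff)
  then show ?thesis
    by (simp add: h2_norm_superset[of "supp p"] norm_mult L2_set_right_distrib mult.assoc)
qed

lemma h2_norm_minus [simp]: "h2_norm (- p) = h2_norm p"
  by (intro antisym h2_norm_mono) auto

lemma h2_norm_triangle_diff: "h2_norm (p - q) \<le> h2_norm p + h2_norm q"
  using h2_norm_triangle[of p "- q"] by simp

lemma h2_norm_sum_le: "h2_norm (sum f A) \<le> (\<Sum>x\<in>A. h2_norm (f x))"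
proof (induction A rule: infinite_finite_induct)
  case (insert x A)
  then show ?case using h2_norm_triangle[of "f x" "sum f A"] by simp
qed auto

text \<open>This ratio drives the analysis: being at most 1, it makes every variable a contraction;
  it is the factor in the adjoint \<open>bshift\<close>; and along a ray in direction
  \<open>i\<close> it tends to 1.\<close>

lemma h2_weight_unit_idx_add:
  "h2_weight (unit_idx i + \<alpha>) = h2_weight \<alpha> * (real (coef \<alpha> i) + 1) / (real (\<Sum>j\<in>UNIV. coef \<alpha> j) + 1)"
proof -
  have "(\<Prod>j\<in>UNIV. fact (coef (unit_idx i + \<alpha>) j) :: real)
      = (\<Prod>j\<in>UNIV. (if j = i then real (coef \<alpha> i) + 1 else 1) * fact (coef \<alpha> j))"
    by (intro prod.cong refl) (simp add: lookup_add lookup_single when_def)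
  also have "\<dots> = (real (coef \<alpha> i) + 1) * (\<Prod>j\<in>UNIV. fact (coef \<alpha> j))"
    by (simp add: prod.distrib)
  finally show ?thesis
    by (simp add: h2_weight_def lookup_add sum.distrib lookup_single when_def algebra_simps)
qed

lemma h2_weight_unit_idx_add_le: "h2_weight (unit_idx i + \<alpha>) \<le> h2_weight \<alpha>"
proof -
  have "coef \<alpha> i \<le> (\<Sum>j\<in>UNIV. coef \<alpha> j)"
    by (rule member_le_sum) auto
  then have "real (coef \<alpha> i) \<le> real (\<Sum>j\<in>UNIV. coef \<alpha> j)"
    by (rule of_nat_mono)
  then have "(real (coef \<alpha> i) + 1) / (real (\<Sum>j\<in>UNIV. coef \<alpha> j) + 1) \<le> 1"
    by (subst divide_le_eq_1_pos) linarith+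
  from mult_left_mono[OF this, of "h2_weight \<alpha>"] show ?thesis
    unfolding h2_weight_unit_idx_add by (simp add: h2_weight_pos less_imp_le)
qed

lemma h2_weight_le_1: "h2_weight \<alpha> \<le> 1"
proof (induction \<alpha> rule: multi_index_induct)
  case zero
  show ?case by (simp add: h2_weight_def)
next
  case (unit i \<alpha>)
  then show ?case using h2_weight_unit_idx_add_le[of i \<alpha>] by linarith
qed

lemma h2_norm_Var_mult_le: "h2_norm (Var i * p) \<le> h2_norm p"
proof -
  have inj: "inj_on (\<lambda>\<alpha>. unit_idx i + \<alpha>) (supp p)" by (auto intro: inj_onI)
  have "h2_norm (Var i * p) = L2_set (\<lambda>\<alpha>. cmod (coef (Var i * p) \<alpha>) * sqrt (h2_weight \<alpha>)) ((\<lambda>\<alpha>. unit_idx i + \<alpha>) ` supp p)"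
    by (rule h2_norm_superset) (auto simp: supp_Var_mult)
  also have "\<dots> = L2_set (\<lambda>\<alpha>. cmod (coef p \<alpha>) * sqrt (h2_weight (unit_idx i + \<alpha>))) (supp p)"
    by (simp add: L2_set_def sum.reindex[OF inj] coef_Var_mult lookup_add)
  also have "\<dots> \<le> h2_norm p"
    by (subst h2_norm_superset[OF finite_keys order_refl])
       (auto intro!: L2_set_mono mult_left_mono simp: h2_weight_unit_idx_add_le h2_weight_pos less_imp_le)
  finally show ?thesis .
qed

lemma h2_norm_Var_power_mult_le: "h2_norm (Var i ^ n * p) \<le> h2_norm p"
proof (induction n)
  case (Suc n)
  then show ?case using h2_norm_Var_mult_le[of i "Var i ^ n * p"] by (simp add: mult.assoc)
qed simp

text \<open>Constants scale the norm, variables are contractions, and bounds add up. The constant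
  depends on \<open>f\<close> alone.\<close>

lemma h2_norm_mult_bounded: "\<exists>C\<ge>0. \<forall>p. h2_norm (f * p) \<le> C * h2_norm p"
proof (induction f rule: mpoly_induct)
  case (Cst c)
  show ?case by (rule exI[of _ "cmod c"]) (simp add: h2_norm_Cst_mult)
next
  case (Var i f)
  then show ?case
    using order_trans[OF h2_norm_Var_mult_le] by (metis mult.assoc)
next
  case (add f g)
  then obtain C D where *: "C \<ge> 0" "D \<ge> 0" "\<And>p. h2_norm (f * p) \<le> C * h2_norm p" "\<And>p. h2_norm (g * p) \<le> D * h2_norm p"
    by blast
  have "h2_norm ((f + g) * p) \<le> (C + D) * h2_norm p" for p
    using h2_norm_triangle[of "f * p" "g * p"] *(3,4)[of p] by (simp add: algebra_simps)
  then show ?case using * by (intro exI[of _ "C + D"]) auto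
qed

lemma coef_le_h2_norm: "cmod (coef p \<alpha>) * sqrt (h2_weight \<alpha>) \<le> h2_norm p"
proof -
  have "cmod (coef p \<alpha>) * sqrt (h2_weight \<alpha>) \<le> L2_set (\<lambda>\<alpha>. cmod (coef p \<alpha>) * sqrt (h2_weight \<alpha>)) (insert \<alpha> (supp p))"
    by (rule member_le_L2_set) auto
  also have "\<dots> = h2_norm p"
    by (rule h2_norm_superset[symmetric]) auto
  finally show ?thesis .
qed

section \<open>Bounded division and comaximal ideals\<close>

lemma ideal_0: "is_ideal I \<Longrightarrow> 0 \<in> I"
  and ideal_add: "is_ideal I \<Longrightarrow> x \<in> I \<Longrightarrow> y \<in> I \<Longrightarrow> x + y \<in> I"
  and ideal_diff: "is_ideal I \<Longrightarrow> x \<in> I \<Longrightarrow> y \<in> I \<Longrightarrow> x - y \<in> I"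
  and ideal_mult: "is_ideal I \<Longrightarrow> x \<in> I \<Longrightarrow> c * x \<in> I"
  and ideal_sum: "is_ideal I \<Longrightarrow> (\<And>x. x \<in> B \<Longrightarrow> f x \<in> I) \<Longrightarrow> sum f B \<in> I"
  by (fact module.subspace_0[OF module_times] module.subspace_add[OF module_times]
      module.subspace_diff[OF module_times] module.subspace_scale[OF module_times]
      module.subspace_sum[OF module_times])+

lemma ideal_eq_UNIV: "is_ideal I \<Longrightarrow> 1 \<in> I \<Longrightarrow> x \<in> I"
  using ideal_mult[of I 1 x] by simp

text \<open>A bound on each term in place of the sum of squares: for finite \<open>F\<close> this is
  the same up to a factor, and it behaves well under unions of generating sets.\<close>

definition bdiv :: "'n::finite mpoly set \<Rightarrow> real \<Rightarrow> 'n mpoly \<Rightarrow> bool" where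
  "bdiv F B h \<longleftrightarrow> (\<exists>a. h = (\<Sum>f\<in>F. a f * f) \<and> (\<forall>f\<in>F. h2_norm (a f * f) \<le> B))"

text \<open>There are \<open>card F\<close> squares, each at most that of
  \<open>C * h2_norm h\<close>. That \<open>F\<close> generates \<open>I\<close> can be read off
  from the representations themselves.\<close>

lemma stable_divisionI:
  assumes I: "is_ideal I" and F: "finite F" "F \<subseteq> I"
    and "\<And>h. h \<in> I \<Longrightarrow> bdiv F (C * h2_norm h) h"
  shows "stable_division_property h2_norm I"
  unfolding stable_division_property_def
proof (rule exI[of _ F], rule exI[of _ "card F * C\<^sup>2"], intro conjI ballI)
  show "ideal_generated F = I"
  proof (rule module.span_subspace[OF module_times])
    show "I \<subseteq> ideal_generated F"
    proof
      fix h assume "h \<in> I"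
      with assms(4) obtain a where "h = (\<Sum>f\<in>F. a f * f)" unfolding bdiv_def by blast
      then show "h \<in> ideal_generated F"
        using module.span_finite[OF module_times F(1)] by auto
    qed
  qed (use assms in auto)
next
  fix h assume "h \<in> I"
  with assms(4) obtain a where a: "h = (\<Sum>f\<in>F. a f * f)" "\<And>f. f \<in> F \<Longrightarrow> h2_norm (a f * f) \<le> C * h2_norm h"
    unfolding bdiv_def by blast
  have "(\<Sum>f\<in>F. (h2_norm (a f * f))\<^sup>2) \<le> (\<Sum>f\<in>F. (C * h2_norm h)\<^sup>2)"
    by (intro sum_mono power_mono a) auto
  then have "(\<Sum>f\<in>F. (h2_norm (a f * f))\<^sup>2) \<le> (card F * C\<^sup>2) * (h2_norm h)\<^sup>2"
    by (simp add: power_mult_distrib)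
  with a(1) show "\<exists>a. h = (\<Sum>f\<in>F. a f * f) \<and> (\<Sum>f\<in>F. (h2_norm (a f * f))\<^sup>2) \<le> (card F * C\<^sup>2) * (h2_norm h)\<^sup>2"
    by blast
qed (use F in auto)

lemma stable_divisionD:
  assumes "stable_division_property h2_norm I"
  shows "\<exists>F C. finite F \<and> F \<subseteq> I \<and> C \<ge> 0 \<and> (\<forall>h\<in>I. bdiv F (C * h2_norm h) h)"
proof -
  obtain F C where F: "finite F" "F \<subseteq> I"
    and *: "\<And>h. h \<in> I \<Longrightarrow> \<exists>a. h = (\<Sum>f\<in>F. a f * f) \<and> (\<Sum>f\<in>F. (h2_norm (a f * f))\<^sup>2) \<le> C * (h2_norm h)\<^sup>2"
    using assms unfolding stable_division_property_def by blast
  show ?thesis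
  \<comment> \<open>The given \<open>C\<close> may be negative, hence the absolute value under the
    root.\<close>
  proof (rule exI[of _ F], rule exI[of _ "sqrt \<bar>C\<bar>"], intro conjI ballI F)
    fix h assume "h \<in> I"
    then obtain a where a: "h = (\<Sum>f\<in>F. a f * f)" "(\<Sum>f\<in>F. (h2_norm (a f * f))\<^sup>2) \<le> C * (h2_norm h)\<^sup>2"
      using * by blast
    have "h2_norm (a f * f) \<le> sqrt \<bar>C\<bar> * h2_norm h" if "f \<in> F" for f
    proof -
      have "(h2_norm (a f * f))\<^sup>2 \<le> (\<Sum>f\<in>F. (h2_norm (a f * f))\<^sup>2)"
        by (rule member_le_sum) (use that F in auto)
      also have "\<dots> \<le> \<bar>C\<bar> * (h2_norm h)\<^sup>2"
        using a(2) by (meson abs_ge_self mult_right_mono order_trans zero_le_power2)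
      also have "\<dots> = (sqrt \<bar>C\<bar> * h2_norm h)\<^sup>2"
        by (simp add: power_mult_distrib)
      finally show ?thesis
        by (rule power2_le_imp_le) simp
    qed
    with a(1) show "bdiv F (sqrt \<bar>C\<bar> * h2_norm h) h"
      unfolding bdiv_def by blast
  qed simp
qed

lemma bdiv_mono: "bdiv F B h \<Longrightarrow> B \<le> B' \<Longrightarrow> bdiv F B' h"
  unfolding bdiv_def using order_trans by blast

lemma bdiv_single: "h2_norm (a * f) \<le> B \<Longrightarrow> bdiv {f} B (a * f)"
  unfolding bdiv_def by (intro exI[of _ "\<lambda>_. a"]) simp

text \<open>Both coefficient families are extended by zero. A generator common to \<open>F\<close>
  and \<open>G\<close> receives both terms, hence the bound \<open>B + B'\<close>.\<close>

lemma bdiv_add: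
  assumes "finite F" "finite G" "bdiv F B h" "bdiv G B' h'" "0 \<le> B" "0 \<le> B'"
  shows "bdiv (F \<union> G) (B + B') (h + h')"
proof -
  obtain a where a: "h = (\<Sum>f\<in>F. a f * f)" "\<And>f. f \<in> F \<Longrightarrow> h2_norm (a f * f) \<le> B"
    using assms unfolding bdiv_def by blast
  obtain b where b: "h' = (\<Sum>f\<in>G. b f * f)" "\<And>f. f \<in> G \<Longrightarrow> h2_norm (b f * f) \<le> B'"
    using assms unfolding bdiv_def by blast
  define a' b' where "a' f = (if f \<in> F then a f else 0)" and "b' f = (if f \<in> G then b f else 0)" for f
  have "h = (\<Sum>f\<in>F \<union> G. a' f * f)" "h' = (\<Sum>f\<in>F \<union> G. b' f * f)"
    unfolding a b by (intro sum.mono_neutral_cong_left; use assms in \<open>auto simp: a'_def b'_def\<close>)+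
  then have "h + h' = (\<Sum>f\<in>F \<union> G. (a' f + b' f) * f)"
    by (simp add: sum.distrib algebra_simps)
  moreover have "h2_norm ((a' f + b' f) * f) \<le> B + B'" for f
  proof -
    have "h2_norm (a' f * f) \<le> B" "h2_norm (b' f * f) \<le> B'"
      using a(2)[of f] b(2)[of f] assms by (auto simp: a'_def b'_def)
    then show ?thesis
      using h2_norm_triangle[of "a' f * f" "b' f * f"] by (simp add: algebra_simps)
  qed
  ultimately show ?thesis
    unfolding bdiv_def by (intro exI[of _ "\<lambda>f. a' f + b' f"]) blast
qed

lemma bdiv_sum:
  assumes "finite K" "\<And>k. k \<in> K \<Longrightarrow> finite (F k)" "\<And>k. k \<in> K \<Longrightarrow> bdiv (F k) (B k) (h k)" "\<And>k. k \<in> K \<Longrightarrow> 0 \<le> B k"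
  shows "bdiv (\<Union>k\<in>K. F k) (\<Sum>k\<in>K. B k) (\<Sum>k\<in>K. h k)"
  using assms
proof (induction K)
  case empty
  show ?case by (simp add: bdiv_def)
next
  case (insert k K)
  have "bdiv (F k \<union> (\<Union>k\<in>K. F k)) (B k + (\<Sum>k\<in>K. B k)) (h k + (\<Sum>k\<in>K. h k))"
    by (rule bdiv_add) (use insert in \<open>auto intro: sum_nonneg\<close>)
  then show ?case using insert by simp
qed

text \<open>Multiplication by \<open>t\<close> may identify generators (for \<open>t = 0\<close> it
  does), so coefficients are summed over the fibres of the map. A fibre has at most
  \<open>card F\<close> elements, which gives the factor.\<close>

lemma bdiv_mult:
  fixes B D :: real
  assumes F: "finite F" and h: "bdiv F B h" and B: "0 \<le> B" and D: "0 \<le> D" "\<And>p. h2_norm (t * p) \<le> D * h2_norm p"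
  shows "bdiv ((*) t ` F) (card F * (D * B)) (t * h)"
proof -
  obtain a where a: "h = (\<Sum>f\<in>F. a f * f)" "\<And>f. f \<in> F \<Longrightarrow> h2_norm (a f * f) \<le> B"
    using h unfolding bdiv_def by blast
  define b where "b g = (\<Sum>f\<in>{f\<in>F. t * f = g}. a f)" for g
  have b: "b g * g = (\<Sum>f\<in>{f\<in>F. t * f = g}. t * (a f * f))" for g
    unfolding b_def sum_distrib_right by (rule sum.cong) (auto simp: mult_ac)
  have "t * h = (\<Sum>f\<in>F. t * (a f * f))"
    by (simp add: a(1) sum_distrib_left)
  also have "\<dots> = (\<Sum>g\<in>(*) t ` F. b g * g)"
    unfolding b by (rule sum.image_gen[OF F])
  finally have "t * h = (\<Sum>g\<in>(*) t ` F. b g * g)" .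
  moreover have "h2_norm (b g * g) \<le> card F * (D * B)" for g
  proof -
    have "h2_norm (b g * g) \<le> (\<Sum>f\<in>{f\<in>F. t * f = g}. h2_norm (t * (a f * f)))"
      unfolding b by (rule h2_norm_sum_le)
    also have "\<dots> \<le> (\<Sum>f\<in>{f\<in>F. t * f = g}. D * B)"
      by (intro sum_mono order_trans[OF D(2)] mult_left_mono a D) auto
    also have "\<dots> = card {f\<in>F. t * f = g} * (D * B)"
      by simp
    also have "\<dots> \<le> card F * (D * B)"
      by (intro mult_right_mono of_nat_mono card_mono) (use F B D in auto)
    finally show ?thesis .
  qed
  ultimately show ?thesis
    unfolding bdiv_def by blast
qed

lemma stable_division_comaximal:
  assumes I: "is_ideal I" "I \<subseteq> I1" "I \<subseteq> I2" and st: "s + t = 1"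
    and t: "\<And>x. x \<in> I1 \<Longrightarrow> t * x \<in> I" and s: "\<And>x. x \<in> I2 \<Longrightarrow> s * x \<in> I"
    and I1: "stable_division_property h2_norm I1" and I2: "stable_division_property h2_norm I2"
  shows "stable_division_property h2_norm I"
proof -
  obtain F C where F: "finite F" "F \<subseteq> I1" "C \<ge> 0" "\<And>h. h \<in> I1 \<Longrightarrow> bdiv F (C * h2_norm h) h"
    using stable_divisionD[OF I1] by blast
  obtain G C' where G: "finite G" "G \<subseteq> I2" "C' \<ge> 0" "\<And>h. h \<in> I2 \<Longrightarrow> bdiv G (C' * h2_norm h) h"
    using stable_divisionD[OF I2] by blast
  obtain D where D: "0 \<le> D" "\<And>p. h2_norm (t * p) \<le> D * h2_norm p"
    using h2_norm_mult_bounded by blast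
  obtain D' where D': "0 \<le> D'" "\<And>p. h2_norm (s * p) \<le> D' * h2_norm p"
    using h2_norm_mult_bounded by blast
  show ?thesis
  proof (rule stable_divisionI[OF I(1)])
    fix h assume h: "h \<in> I"
    have "bdiv ((*) t ` F \<union> (*) s ` G) (card F * (D * (C * h2_norm h)) + card G * (D' * (C' * h2_norm h))) (t * h + s * h)"
    proof (rule bdiv_add)
      show "bdiv ((*) t ` F) (card F * (D * (C * h2_norm h))) (t * h)"
        by (rule bdiv_mult) (use F D h I in auto)
      show "bdiv ((*) s ` G) (card G * (D' * (C' * h2_norm h))) (s * h)"
        by (rule bdiv_mult) (use G D' h I in auto)
    qed (use F G D D' in auto)
    moreover have "t * h + s * h = h"
      using st by (simp add: add.commute[of t] flip: distrib_right)
    ultimately show "bdiv ((*) t ` F \<union> (*) s ` G) ((card F * (D * C) + card G * (D' * C')) * h2_norm h) h"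
      by (simp add: algebra_simps)
  qed (use F G s t in auto)
qed

section \<open>Zero-dimensional ideals\<close>

text \<open>Moving polynomials in one variable to \<open>complex poly\<close> gives access to the
  fundamental theorem of algebra and to orders of roots.\<close>

definition upoly :: "'n \<Rightarrow> complex poly \<Rightarrow> 'n mpoly" where
  "upoly i p = poly (map_poly Cst p) (Var i)"

lemma upoly_0 [simp]: "upoly i 0 = 0"
  by (simp add: upoly_def)

lemma upoly_pCons: "upoly i (pCons a p) = Cst a + Var i * upoly i p"
  by (simp add: upoly_def map_poly_pCons)

lemma upoly_1 [simp]: "upoly i 1 = 1"
  by (simp add: one_pCons upoly_pCons)

lemma upoly_add: "upoly i (p + q) = upoly i p + upoly i q"
  by (induction p q rule: poly_induct2) (simp_all add: upoly_pCons Cst_add algebra_simps)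

lemma upoly_smult: "upoly i (smult c p) = Cst c * upoly i p"
  by (induction p) (simp_all add: upoly_pCons Cst_mult algebra_simps)

lemma upoly_mult: "upoly i (p * q) = upoly i p * upoly i q"
  by (induction p) (simp_all add: upoly_pCons upoly_add upoly_smult algebra_simps)

lemma upoly_sum: "upoly i (sum f A) = (\<Sum>x\<in>A. upoly i (f x))"
  by (induction A rule: infinite_finite_induct) (simp_all add: upoly_add)

lemma upoly_prod: "upoly i (prod f A) = (\<Prod>x\<in>A. upoly i (f x))"
  by (induction A rule: infinite_finite_induct) (simp_all add: upoly_mult)

lemma upoly_power: "upoly i (p ^ n) = upoly i p ^ n"
  by (induction n) (simp_all add: upoly_mult)

lemma upoly_linear: "upoly i [:- c, 1:] = Var i - Cst c"
  using Cst_diff[of 0 c] by (simp add: upoly_pCons)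

section \<open>Adjoining elements and the weak Nullstellensatz\<close>

definition ideal_adjoin :: "'a::comm_ring_1 set \<Rightarrow> 'a \<Rightarrow> 'a set" where
  "ideal_adjoin I f = {x + g * f | x g. x \<in> I}"

lemma ideal_adjoin: "is_ideal I \<Longrightarrow> is_ideal (ideal_adjoin I f)"
  unfolding module.subspace_def[OF module_times]
proof (intro conjI ballI allI)
  assume I: "0 \<in> I \<and> (\<forall>x\<in>I. \<forall>y\<in>I. x + y \<in> I) \<and> (\<forall>c. \<forall>x\<in>I. c * x \<in> I)"
  show "0 \<in> ideal_adjoin I f"
    unfolding ideal_adjoin_def by (rule CollectI, rule exI[of _ 0], rule exI[of _ 0]) (use I in simp)
  fix x y assume "x \<in> ideal_adjoin I f" "y \<in> ideal_adjoin I f"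
  then obtain u v g h where "x = u + g * f" "y = v + h * f" "u \<in> I" "v \<in> I"
    unfolding ideal_adjoin_def by blast
  then have "x + y = (u + v) + (g + h) * f" "u + v \<in> I"
    using I by (auto simp: algebra_simps)
  then show "x + y \<in> ideal_adjoin I f"
    unfolding ideal_adjoin_def by blast
next
  assume I: "0 \<in> I \<and> (\<forall>x\<in>I. \<forall>y\<in>I. x + y \<in> I) \<and> (\<forall>c. \<forall>x\<in>I. c * x \<in> I)"
  fix c x assume "x \<in> ideal_adjoin I f"
  then obtain u g where "x = u + g * f" "u \<in> I"
    unfolding ideal_adjoin_def by blast
  then have "c * x = c * u + (c * g) * f" "c * u \<in> I"
    using I by (auto simp: algebra_simps)
  then show "c * x \<in> ideal_adjoin I f"
    unfolding ideal_adjoin_def by blast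
qed

lemma ideal_adjoin_superset: "I \<subseteq> ideal_adjoin I f"
proof
  fix x assume "x \<in> I"
  then have "x = x + 0 * f \<and> x \<in> I" by simp
  then show "x \<in> ideal_adjoin I f" unfolding ideal_adjoin_def by blast
qed

lemma ideal_adjoin_generator: "is_ideal I \<Longrightarrow> f \<in> ideal_adjoin I f"
proof -
  assume "is_ideal I"
  then have "f = 0 + 1 * f \<and> 0 \<in> I" by (simp add: ideal_0)
  then show ?thesis unfolding ideal_adjoin_def by blast
qed

text \<open>Gaussian elimination: an element with nonzero coefficient at \<alpha> is the pivot that
  clears \<alpha> from the others. The relation is indexed by \<open>c\<close> and not by the
  vectors \<open>g c\<close>, which may coincide.\<close>

lemma linear_relation:
  fixes g :: "'c \<Rightarrow> 'n::finite mpoly"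
  assumes "finite S" "infinite U" "\<And>c. c \<in> U \<Longrightarrow> supp (g c) \<subseteq> S"
  shows "\<exists>T x. finite T \<and> T \<subseteq> U \<and> (\<exists>t\<in>T. x t \<noteq> 0) \<and> (\<Sum>t\<in>T. Cst (x t) * g t) = 0"
  using assms
proof (induction S arbitrary: U g)
  case empty
  from empty(1) obtain t where "t \<in> U" using infinite_imp_nonempty by blast
  with empty show ?case by (intro exI[of _ "{t}"] exI[of _ "\<lambda>_. 1"]) (auto simp: keys_eq_empty)
next
  case (insert \<alpha> S)
  show ?case
  proof (cases "\<forall>c\<in>U. coef (g c) \<alpha> = 0")
    case True
    then have "supp (g c) \<subseteq> S" if "c \<in> U" for c
      using insert.prems(2)[OF that] that by (auto simp: in_keys_iff)
    with insert.IH[OF insert.prems(1)] show ?thesis by blast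
  next
    case False
    then obtain t where t: "t \<in> U" "coef (g t) \<alpha> \<noteq> 0" by blast
    define r where "r c = coef (g c) \<alpha> / coef (g t) \<alpha>" for c
    have "supp (g c - Cst (r c) * g t) \<subseteq> S" if "c \<in> U - {t}" for c
    proof
      fix \<beta> assume \<beta>: "\<beta> \<in> supp (g c - Cst (r c) * g t)"
      then have "\<beta> \<in> supp (g c) \<union> supp (g t)" by (auto simp: in_keys_iff lookup_minus)
      then have "\<beta> \<in> insert \<alpha> S" using insert.prems(2) t that by blast
      moreover have "\<beta> \<noteq> \<alpha>" using \<beta> t by (auto simp: in_keys_iff lookup_minus r_def)
      ultimately show "\<beta> \<in> S" by blast
    qed
    then have "\<exists>T x. finite T \<and> T \<subseteq> U - {t} \<and> (\<exists>s\<in>T. x s \<noteq> 0) \<and> (\<Sum>s\<in>T. Cst (x s) * (g s - Cst (r s) * g t)) = 0"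
      using insert.prems(1) by (intro insert.IH) auto
    then obtain T x where T: "finite T" "T \<subseteq> U - {t}" "\<exists>s\<in>T. x s \<noteq> 0" "(\<Sum>s\<in>T. Cst (x s) * (g s - Cst (r s) * g t)) = 0"
      by blast
    \<comment> \<open>The coefficient at the pivot collects the multiples of \<open>g t\<close> that
      the elimination subtracted.\<close>
    define y where "y = x(t := - (\<Sum>s\<in>T. x s * r s))"
    have s1: "(\<Sum>s\<in>insert t T. Cst (y s) * g s) = Cst (y t) * g t + (\<Sum>s\<in>T. Cst (y s) * g s)"
      using T by (subst sum.insert) auto
    have s2: "(\<Sum>s\<in>T. Cst (y s) * g s) = (\<Sum>s\<in>T. Cst (x s) * g s)"
      using T by (intro sum.cong) (auto simp: y_def)
    have s3: "Cst (y t) = - (\<Sum>s\<in>T. Cst (x s) * Cst (r s))"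
      using Cst_diff[of 0 "\<Sum>s\<in>T. x s * r s"] by (simp add: y_def Cst_mult Cst_sum)
    have s4: "- (\<Sum>s\<in>T. Cst (x s) * Cst (r s)) * g t + (\<Sum>s\<in>T. Cst (x s) * g s)
        = (\<Sum>s\<in>T. Cst (x s) * (g s - Cst (r s) * g t))"
      by (simp add: right_diff_distrib sum_subtractf sum_distrib_right mult.assoc)
    have "(\<Sum>s\<in>insert t T. Cst (y s) * g s) = 0" unfolding s1 s2 s3 s4 by (rule T(4))
    moreover have "\<exists>s\<in>insert t T. y s \<noteq> 0"
      using T by (auto simp: y_def)
    ultimately show ?thesis
      using T t by (intro exI[of _ "insert t T"] exI[of _ y]) auto
  qed
qed

lemma finite_multi_index_less: "finite {\<alpha> :: 'n::finite \<Rightarrow>\<^sub>0 nat. \<forall>i. coef \<alpha> i < N}"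
proof (rule finite_imageD)
  show "finite (Poly_Mapping.lookup ` {\<alpha> :: 'n \<Rightarrow>\<^sub>0 nat. \<forall>i. coef \<alpha> i < N})"
  proof (rule finite_subset)
    show "Poly_Mapping.lookup ` {\<alpha> :: 'n \<Rightarrow>\<^sub>0 nat. \<forall>i. coef \<alpha> i < N} \<subseteq> PiE UNIV (\<lambda>_. {..<N})"
      by (simp add: image_subset_iff PiE_UNIV_domain Pi_iff)
    show "finite (PiE (UNIV :: 'n set) (\<lambda>_. {..<N}))"
      by (rule finite_PiE) simp_all
  qed
  show "inj_on Poly_Mapping.lookup {\<alpha> :: 'n \<Rightarrow>\<^sub>0 nat. \<forall>i. coef \<alpha> i < N}"
    by (auto intro!: inj_onI poly_mapping_eqI)
qed

lemma multi_index_bounded: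
  fixes S :: "('n::finite \<Rightarrow>\<^sub>0 nat) set"
  assumes "finite S"
  shows "\<exists>N. \<forall>\<alpha>\<in>S. \<forall>i. coef \<alpha> i < N"
proof (intro exI ballI allI)
  fix \<alpha> i assume "\<alpha> \<in> S"
  have "coef \<alpha> i \<le> (\<Sum>i\<in>UNIV. coef \<alpha> i)"
    by (rule member_le_sum) auto
  also have "\<dots> \<le> (\<Sum>\<alpha>\<in>S. \<Sum>i\<in>UNIV. coef \<alpha> i)"
    by (rule member_le_sum) (use assms \<open>\<alpha> \<in> S\<close> in auto)
  finally show "coef \<alpha> i < Suc (\<Sum>\<alpha>\<in>S. \<Sum>i\<in>UNIV. coef \<alpha> i)" by simp
qed

text \<open>
  The quotient by \<open>I\<close> has countable dimension, so uncountably many inverses of \<open>z\<^sub>i - c\<close> in it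
  satisfy a linear relation; clearing denominators gives the polynomial.
\<close>

lemma upoly_in_ideal_if_invertible:
  fixes I :: "'n::finite mpoly set"
  assumes I: "is_ideal I" and U: "uncountable U"
    and inv: "\<And>c. c \<in> U \<Longrightarrow> \<exists>g. g * (Var i - Cst c) - 1 \<in> I"
  shows "\<exists>p. p \<noteq> 0 \<and> upoly i p \<in> I"
proof -
  obtain g where g: "\<And>c. c \<in> U \<Longrightarrow> g c * (Var i - Cst c) - 1 \<in> I"
    using inv by metis
  \<comment> \<open>Stratifying \<open>U\<close> by the exponents occurring in the inverse gives
    countably many strata, so one of them is uncountable, and its inverses lie in one
    finite-dimensional space.\<close>
  define V where "V N = {c\<in>U. supp (g c) \<subseteq> {\<alpha>. \<forall>i. coef \<alpha> i < N}}" for N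
  have "U = (\<Union>N. V N)"
  proof (intro equalityI subsetI)
    fix c assume "c \<in> U"
    moreover obtain N where "\<forall>\<alpha>\<in>supp (g c). \<forall>i. coef \<alpha> i < N"
      using multi_index_bounded[OF finite_keys] by blast
    ultimately show "c \<in> (\<Union>N. V N)" by (auto simp: V_def)
  qed (auto simp: V_def)
  have "\<exists>N. uncountable (V N)"
  proof (rule ccontr)
    assume "\<not> ?thesis"
    then have "countable (\<Union>N. V N)" by (intro countable_UN) auto
    with U \<open>U = (\<Union>N. V N)\<close> show False by simp
  qed
  then obtain N where "infinite (V N)"
    using uncountable_infinite by blast
  then have "\<exists>T x. finite T \<and> T \<subseteq> V N \<and> (\<exists>t\<in>T. x t \<noteq> 0) \<and> (\<Sum>t\<in>T. Cst (x t) * g t) = 0"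
    by (rule linear_relation[OF finite_multi_index_less[of N]]) (simp add: V_def)
  then obtain T x where T: "finite T" "T \<subseteq> V N" "\<exists>t\<in>T. x t \<noteq> 0" "(\<Sum>t\<in>T. Cst (x t) * g t) = 0"
    by blast
  \<comment> \<open>The numerator of the sum of the fractions x_t / (z - t) over the common
    denominator.\<close>
  define p where "p = (\<Sum>t\<in>T. smult (x t) (\<Prod>s\<in>T - {t}. [:- s, 1:]))"
  obtain t where t: "t \<in> T" "x t \<noteq> 0" using T by blast
  \<comment> \<open>At a point \<open>t\<close> of \<open>T\<close> all summands but the one
    belonging to \<open>t\<close> vanish, so a nonzero \<open>x t\<close> shows that
    \<open>p\<close> is nonzero.\<close>
  have "poly p t = (\<Sum>s\<in>T. if s = t then x t * (\<Prod>s\<in>T - {t}. t - s) else 0)"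
    unfolding p_def poly_sum
  proof (rule sum.cong)
    fix s assume "s \<in> T"
    then show "poly (smult (x s) (\<Prod>s\<in>T - {s}. [:- s, 1:])) t = (if s = t then x t * (\<Prod>s\<in>T - {t}. t - s) else 0)"
      using T t by (auto simp: poly_prod)
  qed simp
  also have "\<dots> \<noteq> 0"
    using T t by (auto simp: prod_zero_iff)
  finally have "p \<noteq> 0" by auto
  \<comment> \<open>Modulo \<open>I\<close>, \<open>g t\<close> times the full product is the
    product without the factor of \<open>t\<close>; summed up, the relation turns into membership of
    \<open>upoly i p\<close>.\<close>
  have "Cst (x t) * ((\<Prod>s\<in>T - {t}. Var i - Cst s) - g t * (\<Prod>s\<in>T. Var i - Cst s)) \<in> I" if "t \<in> T" for t
  proof -
    have "g t * (\<Prod>s\<in>T. Var i - Cst s) = g t * ((Var i - Cst t) * (\<Prod>s\<in>T - {t}. Var i - Cst s))"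
      using T that by (subst prod.remove[of T t]) auto
    then have "(\<Prod>s\<in>T - {t}. Var i - Cst s) - g t * (\<Prod>s\<in>T. Var i - Cst s)
        = - (\<Prod>s\<in>T - {t}. Var i - Cst s) * (g t * (Var i - Cst t) - 1)"
      by (simp add: algebra_simps)
    moreover have "t \<in> U" using T that by (auto simp: V_def)
    ultimately show ?thesis
      using I g[of t] by (simp only: ideal_mult)
  qed
  then have "(\<Sum>t\<in>T. Cst (x t) * ((\<Prod>s\<in>T - {t}. Var i - Cst s) - g t * (\<Prod>s\<in>T. Var i - Cst s))) \<in> I"
    by (rule ideal_sum[OF I])
  moreover have "(\<Sum>t\<in>T. Cst (x t) * ((\<Prod>s\<in>T - {t}. Var i - Cst s) - g t * (\<Prod>s\<in>T. Var i - Cst s)))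
      = upoly i p - (\<Sum>t\<in>T. Cst (x t) * g t) * (\<Prod>s\<in>T. Var i - Cst s)"
    by (simp add: p_def upoly_sum upoly_smult upoly_prod upoly_linear right_diff_distrib sum_subtractf sum_distrib_right mult.assoc)
  moreover have "upoly i p - (\<Sum>t\<in>T. Cst (x t) * g t) * (\<Prod>s\<in>T. Var i - Cst s) = upoly i p"
    unfolding T(4) by simp
  ultimately have "upoly i p \<in> I" by (simp only:)
  then show ?thesis using \<open>p \<noteq> 0\<close> by blast
qed

text \<open>Each root of \<open>p\<close> contributes a linear factor that is invertible modulo
  \<open>I\<close> and can be cancelled. After \<open>degree p\<close> cancellations a nonzero
  constant of \<open>I\<close> is left.\<close>

lemma ideal_eq_UNIV_if_linear_invertible:
  fixes I :: "'n mpoly set"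
  assumes I: "is_ideal I" and inv: "\<And>c. \<exists>g. g * (Var i - Cst c) - 1 \<in> I"
    and "p \<noteq> 0" "upoly i p \<in> I"
  shows "1 \<in> I"
  using assms(3,4)
proof (induction "degree p" arbitrary: p)
  case 0
  then obtain c where c: "p = [:c:]" by (metis degree_eq_zeroE)
  with 0 have "Cst (1 / c) * Cst c \<in> I"
    using I by (auto simp: upoly_pCons intro: ideal_mult)
  moreover have "Cst (1 / c) * Cst c = (1 :: 'n mpoly)"
    using c 0 by (simp flip: Cst_mult)
  ultimately show ?case by metis
next
  case (Suc n)
  then have "\<not> constant (poly p)" by (simp add: constant_degree)
  then obtain c where "poly p c = 0" using fundamental_theorem_of_algebra by blast
  then obtain q where q: "p = [:- c, 1:] * q" by (auto simp: poly_eq_0_iff_dvd)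
  then have "q \<noteq> 0" "degree p = Suc (degree q)"
    using Suc by (auto simp: degree_mult_eq simp del: mult_pCons_left)
  obtain g where g: "g * (Var i - Cst c) - 1 \<in> I" using inv by blast
  have "g * upoly i p - upoly i q * (g * (Var i - Cst c) - 1) \<in> I"
    by (rule ideal_diff[OF I ideal_mult[OF I] ideal_mult[OF I g]]) (use Suc in simp)
  also have "g * upoly i p - upoly i q * (g * (Var i - Cst c) - 1) = upoly i q"
    unfolding q upoly_mult upoly_linear by (simp add: algebra_simps)
  finally show ?case
    using Suc.hyps \<open>q \<noteq> 0\<close> \<open>degree p = Suc (degree q)\<close> by simp
qed

text \<open>Otherwise every \<open>Var i - Cst c\<close> is invertible modulo \<open>I\<close>. As
  there are uncountably many \<open>c\<close>, the ideal contains a nonzero polynomial in z_i alone,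
  and cancelling its linear factors puts 1 into \<open>I\<close>.\<close>

lemma proper_ideal_adjoin_linear:
  fixes I :: "'n::finite mpoly set"
  assumes I: "is_ideal I" "1 \<notin> I"
  shows "\<exists>c. 1 \<notin> ideal_adjoin I (Var i - Cst c)"
proof (rule ccontr)
  assume *: "\<not> ?thesis"
  have "\<exists>g. g * (Var i - Cst c) - 1 \<in> I" for c
  proof -
    have "1 \<in> ideal_adjoin I (Var i - Cst c)" using * by blast
    then obtain x g where "1 = x + g * (Var i - Cst c)" "x \<in> I" unfolding ideal_adjoin_def by blast
    then have "g * (Var i - Cst c) - 1 = - 1 * x" by (simp add: algebra_simps)
    then show ?thesis using ideal_mult[OF I(1) \<open>x \<in> I\<close>, of "- 1"] by (intro exI[of _ g]) (simp only:)
  qed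
  then have inv: "\<And>c. \<exists>g. g * (Var i - Cst c) - 1 \<in> I" .
  obtain p where "p \<noteq> 0" "upoly i p \<in> I"
    using upoly_in_ideal_if_invertible[OF I(1) uncountable_UNIV_complex inv] by blast
  then show False
    using ideal_eq_UNIV_if_linear_invertible[OF I(1) inv] I(2) by blast
qed

text \<open>This takes the place of a maximal ideal: one adjunction per variable already determines
  a point, so no appeal to Zorn's lemma is made.\<close>

lemma proper_ideal_extend_linear:
  fixes I :: "'n::finite mpoly set"
  assumes I: "is_ideal I" "1 \<notin> I" and "finite S"
  shows "\<exists>J. is_ideal J \<and> 1 \<notin> J \<and> I \<subseteq> J \<and> (\<forall>i\<in>S. \<exists>c. Var i - Cst c \<in> J)"
  using \<open>finite S\<close>
proof induction
  case empty
  then show ?case using I by blast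
next
  case (insert i S)
  then obtain J where J: "is_ideal J" "1 \<notin> J" "I \<subseteq> J" "\<forall>i\<in>S. \<exists>c. Var i - Cst c \<in> J" by blast
  obtain c where c: "1 \<notin> ideal_adjoin J (Var i - Cst c)"
    using proper_ideal_adjoin_linear[OF J(1,2)] by blast
  let ?K = "ideal_adjoin J (Var i - Cst c)"
  have K: "J \<subseteq> ?K" "Var i - Cst c \<in> ?K"
    by (rule ideal_adjoin_superset, rule ideal_adjoin_generator[OF J(1)])
  have "\<exists>c. Var j - Cst c \<in> ?K" if "j \<in> insert i S" for j
  proof (cases "j = i")
    case True
    then show ?thesis using K(2) by metis
  next
    case False
    then have "\<exists>c. Var j - Cst c \<in> J" using J(4) that by simp
    then show ?thesis using K(1) by (meson subsetD)
  qed
  then show ?case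
    using ideal_adjoin[OF J(1)] c order_trans[OF J(3) K(1)] by (intro exI[of _ ?K] conjI ballI)
qed

definition monom_eval :: "('n::finite \<Rightarrow>\<^sub>0 nat) \<Rightarrow> complex ^ 'n \<Rightarrow> complex" where
  "monom_eval \<alpha> z = (\<Prod>i\<in>UNIV. (z $ i) ^ coef \<alpha> i)"

lemma monom_of_cong_ideal:
  fixes J :: "'n::finite mpoly set"
  assumes J: "is_ideal J" and z: "\<And>i. Var i - Cst (z $ i) \<in> J"
  shows "monom_of \<alpha> - Cst (monom_eval \<alpha> z) \<in> J"
proof (induction \<alpha> rule: multi_index_induct)
  case zero
  then show ?case using J by (simp add: monom_eval_def ideal_0)
next
  case (unit i \<alpha>)
  have "monom_eval (unit_idx i + \<alpha>) z = (\<Prod>j\<in>UNIV. (if j = i then z $ i else 1) * (z $ j) ^ coef \<alpha> j)"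
    unfolding monom_eval_def by (rule prod.cong) (auto simp: lookup_add lookup_single when_def)
  also have "\<dots> = z $ i * monom_eval \<alpha> z"
    by (simp add: prod.distrib monom_eval_def)
  finally have *: "monom_eval (unit_idx i + \<alpha>) z = z $ i * monom_eval \<alpha> z" .
  have "monom_of (unit_idx i + \<alpha>) - Cst (monom_eval (unit_idx i + \<alpha>) z)
     = Var i * (monom_of \<alpha> - Cst (monom_eval \<alpha> z)) + Cst (monom_eval \<alpha> z) * (Var i - Cst (z $ i))"
    unfolding * by (simp add: Var_def monom_of_add Cst_mult algebra_simps)
  also have "\<dots> \<in> J"
    using J z unit by (intro ideal_add ideal_mult)
  finally show ?case .
qed

text \<open>A proper \<open>J\<close> containing all z_i - c_i makes every \<open>f\<close>
  congruent to the constant f(c). For \<open>f\<close> in \<open>I\<close> this constant lies in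
  \<open>J\<close>, so it must be 0, and c is a zero of \<open>I\<close>.\<close>

theorem weak_nullstellensatz:
  fixes I :: "'n::finite mpoly set"
  assumes I: "is_ideal I" and V: "affine_variety I = {}"
  shows "1 \<in> I"
proof (rule ccontr)
  assume "1 \<notin> I"
  then obtain J where J: "is_ideal J" "1 \<notin> J" "I \<subseteq> J" "\<forall>i. \<exists>c. Var i - Cst c \<in> J"
    using proper_ideal_extend_linear[OF I, of UNIV] by auto
  then obtain c where c: "\<And>i. Var i - Cst (c i) \<in> J" by metis
  define z where "z = (\<chi> i. c i)"
  have z: "Var i - Cst (z $ i) \<in> J" for i by (simp add: c z_def)
  have "eval_mpoly f z = 0" if "f \<in> I" for f
  proof (rule ccontr)
    assume ne: "eval_mpoly f z \<noteq> 0"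
    have "f - (\<Sum>\<alpha>\<in>supp f. Cst (coef f \<alpha>) * (monom_of \<alpha> - Cst (monom_eval \<alpha> z))) \<in> J"
      using J that by (intro ideal_diff ideal_sum ideal_mult monom_of_cong_ideal z) auto
    also have "f - (\<Sum>\<alpha>\<in>supp f. Cst (coef f \<alpha>) * (monom_of \<alpha> - Cst (monom_eval \<alpha> z)))
        = (f - (\<Sum>\<alpha>\<in>supp f. Cst (coef f \<alpha>) * monom_of \<alpha>)) + (\<Sum>\<alpha>\<in>supp f. Cst (coef f \<alpha>) * Cst (monom_eval \<alpha> z))"
      by (simp add: algebra_simps sum_subtractf)
    also have "\<dots> = Cst (eval_mpoly f z)"
      using mpoly_sum_monom_of[of f] by (simp add: eval_mpoly_def monom_eval_def Cst_sum Cst_mult)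
    finally have "Cst (1 / eval_mpoly f z) * Cst (eval_mpoly f z) \<in> J"
      using J by (intro ideal_mult)
    moreover have "Cst (1 / eval_mpoly f z) * Cst (eval_mpoly f z) = (1 :: 'n mpoly)"
      using ne by (simp flip: Cst_mult)
    ultimately show False using J by simp
  qed
  then have "z \<in> affine_variety I" unfolding affine_variety_def by blast
  with V show False by blast
qed

text \<open>If \<open>c\<close> is not the i-th coordinate of a zero, then adjoining
  \<open>Var i - Cst c\<close> leaves no zeros, so this element is invertible modulo
  \<open>I\<close> by the weak Nullstellensatz. Only finitely many \<open>c\<close> are excluded,
  and the countability argument applies again.\<close>

lemma zero_dimensional_upoly:
  fixes I :: "'n::finite mpoly set"
  assumes I: "is_ideal I" and "zero_dimensional I"
  shows "\<exists>p. p \<noteq> 0 \<and> upoly i p \<in> I"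
proof (rule upoly_in_ideal_if_invertible[OF I])
  let ?V = "(\<lambda>z. z $ i) ` affine_variety I"
  have "countable ?V" using assms by (simp add: zero_dimensional_def countable_finite)
  then show "uncountable (- ?V)"
    using uncountable_UNIV_complex by (metis Compl_partition countable_Un)
  fix c assume c: "c \<in> - ?V"
  let ?J = "ideal_adjoin I (Var i - Cst c)"
  have "affine_variety ?J = {}"
  proof (rule ccontr)
    assume "affine_variety ?J \<noteq> {}"
    then obtain z where z: "z \<in> affine_variety ?J" by blast
    then have "z \<in> affine_variety I"
      using ideal_adjoin_superset[of I "Var i - Cst c"] by (auto simp: affine_variety_def)
    then have "z $ i \<noteq> c" using c by blast
    moreover have "eval_mpoly (Var i - Cst c) z = 0"
      using z ideal_adjoin_generator[OF I] by (auto simp: affine_variety_def)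
    moreover have "eval_mpoly (Var i - Cst c) z = z $ i - c"
    proof -
      have ne: "unit_idx i \<noteq> 0" by (metis lookup_single_eq lookup_zero nat.distinct(1))
      have sub: "supp (Var i - Cst c) \<subseteq> {unit_idx i, 0}"
        by (auto simp: in_keys_iff lookup_minus Var_def coef_monom_of coef_Cst split: if_splits)
      have "eval_mpoly (Var i - Cst c) z = (\<Sum>\<alpha>\<in>{unit_idx i, 0}. coef (Var i - Cst c) \<alpha> * (\<Prod>j\<in>UNIV. (z $ j) ^ coef \<alpha> j))"
        unfolding eval_mpoly_def by (rule sum.mono_neutral_left) (use sub in \<open>auto simp: in_keys_iff\<close>)
      also have "\<dots> = (\<Prod>j\<in>UNIV. (z $ j) ^ coef (unit_idx i) j) - c"
        using ne by (auto simp: lookup_minus Var_def coef_monom_of coef_Cst)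
      also have "(\<Prod>j\<in>UNIV. (z $ j) ^ coef (unit_idx i) j) = (\<Prod>j\<in>UNIV. if j = i then z $ i else 1)"
        by (rule prod.cong) (auto simp: lookup_single when_def)
      finally show ?thesis by simp
    qed
    ultimately show False by simp
  qed
  then have "1 \<in> ?J" by (rule weak_nullstellensatz[OF ideal_adjoin[OF I]])
  then obtain x g where "1 = x + g * (Var i - Cst c)" "x \<in> I" unfolding ideal_adjoin_def by blast
  then have "g * (Var i - Cst c) - 1 = - 1 * x" by (simp add: algebra_simps)
  then show "\<exists>g. g * (Var i - Cst c) - 1 \<in> I" using ideal_mult[OF I \<open>x \<in> I\<close>, of "- 1"] by (intro exI[of _ g]) (simp only:)
qed

lemma zero_dimensional_prod_linear:
  fixes I :: "'n::finite mpoly set"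
  assumes I: "is_ideal I" and "zero_dimensional I"
  shows "\<exists>R k. finite R \<and> (\<Prod>c\<in>R. (Var i - Cst c) ^ k) \<in> I"
proof -
  obtain p where p: "p \<noteq> 0" "upoly i p \<in> I"
    using zero_dimensional_upoly[OF assms] by blast
  let ?R = "{z. poly p z = 0}"
  have fin: "finite ?R" using p(1) by (rule poly_roots_finite)
  \<comment> \<open>Orders of roots are at most \<open>degree p\<close>, so this single exponent
    serves all roots.\<close>
  let ?q = "\<Prod>c\<in>?R. [:- c, 1:] ^ degree p"
  have "smult (lead_coeff p) (\<Prod>c\<in>?R. [:- c, 1:] ^ order c p) dvd ?q"
    using p(1) by (auto simp: smult_dvd_iff intro!: prod_dvd_prod le_imp_power_dvd order_degree)
  then have "p dvd ?q" using complex_poly_decompose[of p] by simp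
  then obtain r where "?q = r * p" by (metis dvdE mult.commute)
  then have "upoly i ?q \<in> I" using p(2) I by (simp only: upoly_mult ideal_mult)
  then have "(\<Prod>c\<in>?R. (Var i - Cst c) ^ degree p) \<in> I"
    by (simp only: upoly_prod upoly_power upoly_linear)
  with fin show ?thesis by blast
qed

section \<open>Unitary substitutions\<close>

definition subst :: "('n::finite \<Rightarrow> 'n mpoly) \<Rightarrow> 'n mpoly \<Rightarrow> 'n mpoly" where
  "subst \<sigma> p = (\<Sum>\<alpha>\<in>supp p. Cst (coef p \<alpha>) * (\<Prod>i\<in>UNIV. \<sigma> i ^ coef \<alpha> i))"

lemma subst_superset:
  assumes "finite A" "supp p \<subseteq> A"
  shows "subst \<sigma> p = (\<Sum>\<alpha>\<in>A. Cst (coef p \<alpha>) * (\<Prod>i\<in>UNIV. \<sigma> i ^ coef \<alpha> i))"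
  unfolding subst_def by (rule sum.mono_neutral_left) (use assms in \<open>auto simp: in_keys_iff\<close>)

lemma subst_add: "subst \<sigma> (p + q) = subst \<sigma> p + subst \<sigma> q"
proof -
  let ?A = "supp p \<union> supp q"
  have A: "finite ?A" "supp p \<subseteq> ?A" "supp q \<subseteq> ?A" "supp (p + q) \<subseteq> ?A"
    by (auto simp: in_keys_iff lookup_add)
  show ?thesis
    unfolding subst_superset[OF A(1,2)] subst_superset[OF A(1,3)] subst_superset[OF A(1,4)]
    by (simp add: lookup_add Cst_add distrib_right sum.distrib)
qed

lemma subst_Cst [simp]: "subst \<sigma> (Cst c :: 'n::finite mpoly) = Cst c"
proof -
  have "supp (Cst c :: 'n mpoly) \<subseteq> {0}" by (auto simp: in_keys_iff coef_Cst split: if_splits)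
  then show ?thesis by (simp add: subst_superset[of "{0}"] coef_Cst)
qed

lemma subst_0 [simp]: "subst \<sigma> 0 = 0"
  by (simp add: subst_def)

lemma subst_1 [simp]: "subst \<sigma> 1 = 1"
  using subst_Cst[of \<sigma> 1] by (simp del: subst_Cst)

lemma subst_Var_mult: "subst \<sigma> (Var i * p) = \<sigma> i * subst \<sigma> p"
proof -
  have inj: "inj_on (\<lambda>\<alpha>. unit_idx i + \<alpha>) (supp p)" by (auto intro: inj_onI)
  have *: "(\<Prod>j\<in>UNIV. \<sigma> j ^ coef (unit_idx i + \<alpha>) j) = \<sigma> i * (\<Prod>j\<in>UNIV. \<sigma> j ^ coef \<alpha> j)" for \<alpha>
  proof -
    have "(\<Prod>j\<in>UNIV. \<sigma> j ^ coef (unit_idx i + \<alpha>) j) = (\<Prod>j\<in>UNIV. (if j = i then \<sigma> i else 1) * \<sigma> j ^ coef \<alpha> j)"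
      by (rule prod.cong) (auto simp: lookup_add lookup_single when_def)
    then show ?thesis by (simp add: prod.distrib)
  qed
  show ?thesis
    unfolding subst_def supp_Var_mult sum.reindex[OF inj] o_def *
    by (simp add: coef_Var_mult lookup_add sum_distrib_left mult.left_commute)
qed

lemma subst_Cst_mult: "subst \<sigma> (Cst c * p) = Cst c * subst \<sigma> p"
proof -
  have "supp (Cst c * p) \<subseteq> supp p" by (auto simp: in_keys_iff)
  then show ?thesis
    by (simp add: subst_superset[of "supp p"] Cst_mult mult.assoc sum_distrib_left)
qed

lemma subst_mult: "subst \<sigma> (p * q) = subst \<sigma> p * subst \<sigma> q"
proof (induction p rule: mpoly_induct)
  case (Cst c)
  show ?case by (simp add: subst_Cst_mult)
next
  case (Var i p)
  then show ?case by (simp add: mult.assoc subst_Var_mult)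
next
  case (add p p')
  then show ?case by (simp add: distrib_right subst_add)
qed

lemma subst_sum: "subst \<sigma> (sum f A) = (\<Sum>x\<in>A. subst \<sigma> (f x))"
  by (induction A rule: infinite_finite_induct) (simp_all add: subst_add)

lemma subst_Var: "subst \<sigma> (Var i) = \<sigma> i"
  using subst_Var_mult[of \<sigma> i 1] by simp

lemma subst_power: "subst \<sigma> (p ^ n) = subst \<sigma> p ^ n"
  by (induction n) (simp_all add: subst_mult)

lemma subst_diff: "subst \<sigma> (p - q) = subst \<sigma> p - subst \<sigma> q"
  using subst_add[of \<sigma> "p - q" q] by (simp add: algebra_simps)

section \<open>Derivatives, adjoint shifts and unitary invariance of the norm\<close>

abbreviation mdeg :: "('n::finite \<Rightarrow>\<^sub>0 nat) \<Rightarrow> nat" where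
  "mdeg \<alpha> \<equiv> \<Sum>i\<in>UNIV. coef \<alpha> i"

lemma mdeg_unit_idx_add: "mdeg (unit_idx i + \<alpha>) = Suc (mdeg \<alpha>)"
  by (simp add: lookup_add sum.distrib lookup_single when_def)

text \<open>The Euler operator plus the identity: the part of degree n is multiplied by n + 1. The
  shift by one makes it injective and cancels the denominators of \<open>bshift\<close>, which turns
  the adjoint shift into a partial derivative.\<close>

definition euler :: "'n::finite mpoly \<Rightarrow> 'n mpoly" where
  "euler = Poly_Mapping.mapp (\<lambda>\<alpha> c. of_nat (Suc (mdeg \<alpha>)) * c)"

definition mderiv :: "'n::finite \<Rightarrow> 'n mpoly \<Rightarrow> 'n mpoly" where
  "mderiv i p = Poly_Mapping.mapp (\<lambda>\<alpha> c. of_nat (Suc (coef \<alpha> i)) * c)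
     (Poly_Mapping.map_key (\<lambda>\<alpha>. unit_idx i + \<alpha>) p)"

text \<open>The adjoint of multiplication by \<open>z\<^sub>i\<close>.\<close>

definition bshift :: "'n::finite \<Rightarrow> 'n mpoly \<Rightarrow> 'n mpoly" where
  "bshift i p = Poly_Mapping.mapp (\<lambda>\<alpha> c. of_nat (Suc (coef \<alpha> i)) / of_nat (Suc (mdeg \<alpha>)) * c)
     (Poly_Mapping.map_key (\<lambda>\<alpha>. unit_idx i + \<alpha>) p)"

lemma coef_euler: "coef (euler p) \<alpha> = of_nat (Suc (mdeg \<alpha>)) * coef p \<alpha>"
  by (simp add: euler_def lookup_mapp when_def in_keys_iff del: of_nat_Suc)

lemma coef_map_key_unit_idx: "coef (Poly_Mapping.map_key (\<lambda>\<alpha>. unit_idx i + \<alpha>) p) \<alpha> = coef p (unit_idx i + \<alpha>)"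
  by (subst Poly_Mapping.map_key.rep_eq) (auto intro: injI)

lemma coef_mderiv: "coef (mderiv i p) \<alpha> = of_nat (Suc (coef \<alpha> i)) * coef p (unit_idx i + \<alpha>)"
  by (simp add: mderiv_def lookup_mapp when_def in_keys_iff coef_map_key_unit_idx del: of_nat_Suc)

lemma coef_bshift:
  "coef (bshift i p) \<alpha> = of_nat (Suc (coef \<alpha> i)) / of_nat (Suc (mdeg \<alpha>)) * coef p (unit_idx i + \<alpha>)"
  by (simp add: bshift_def lookup_mapp when_def in_keys_iff coef_map_key_unit_idx del: of_nat_Suc)

lemma mderiv_add: "mderiv i (p + q) = mderiv i p + mderiv i q"
  by (rule poly_mapping_eqI) (simp add: coef_mderiv lookup_add distrib_left del: of_nat_Suc)

lemma mderiv_Cst_mult: "mderiv i (Cst c * p) = Cst c * mderiv i p"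
  by (rule poly_mapping_eqI) (simp add: coef_mderiv del: of_nat_Suc)

lemma mderiv_Cst [simp]: "mderiv i (Cst c) = 0"
proof (rule poly_mapping_eqI)
  fix \<alpha>
  have "unit_idx i + \<alpha> \<noteq> 0"
    by (metis Suc_neq_Zero lookup_add lookup_single_eq lookup_zero plus_nat.simps(2))
  then show "coef (mderiv i (Cst c)) \<alpha> = coef 0 \<alpha>"
    by (simp add: coef_mderiv coef_Cst)
qed

lemma mderiv_sum: "mderiv i (sum f A) = (\<Sum>x\<in>A. mderiv i (f x))"
proof (induction A rule: infinite_finite_induct)
  case empty
  show ?case using mderiv_Cst[of i 0] by (simp del: mderiv_Cst)
next
  case (infinite A)
  then show ?case using mderiv_Cst[of i 0] by (simp del: mderiv_Cst)
qed (simp add: mderiv_add)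

lemma coef_Var_mult_add: "coef (Var i * p) (unit_idx i + \<alpha>) = coef p \<alpha>"
  by (simp add: coef_Var_mult lookup_add)

lemma mderiv_Var_mult: "mderiv j (Var i * p) = (if i = j then p else 0) + Var i * mderiv j p"
proof (rule poly_mapping_eqI)
  fix \<alpha>
  show "coef (mderiv j (Var i * p)) \<alpha> = coef ((if i = j then p else 0) + Var i * mderiv j p) \<alpha>"
  proof (cases "coef \<alpha> i = 0")
    case True
    then show ?thesis
      by (auto simp: coef_mderiv coef_Var_mult lookup_add lookup_single when_def)
  next
    case False
    then obtain \<gamma> where \<gamma>: "\<alpha> = unit_idx i + \<gamma>"
      by (metis Suc_leI multi_index_split neq0_conv)
    have *: "unit_idx j + (unit_idx i + \<gamma>) = unit_idx i + (unit_idx j + \<gamma>)"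
      by (simp add: add.left_commute)
    show ?thesis
      unfolding \<gamma> coef_mderiv * lookup_add[of "if i = j then p else 0"]
      by (auto simp: coef_mderiv coef_Var_mult_add lookup_add lookup_single distrib_right)
  qed
qed

lemma euler_add: "euler (p + q) = euler p + euler q"
  by (rule poly_mapping_eqI) (simp add: coef_euler lookup_add distrib_left del: of_nat_Suc)

lemma euler_0 [simp]: "euler 0 = 0"
  by (rule poly_mapping_eqI) (simp add: coef_euler)

lemma euler_Cst_mult: "euler (Cst c * p) = Cst c * euler p"
  by (rule poly_mapping_eqI) (simp add: coef_euler del: of_nat_Suc)

lemma euler_sum: "euler (sum f A) = (\<Sum>x\<in>A. euler (f x))"
  by (induction A rule: infinite_finite_induct) (simp_all add: euler_add)

lemma euler_bshift: "euler (bshift i p) = mderiv i p"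
  by (rule poly_mapping_eqI) (simp add: coef_euler coef_bshift coef_mderiv del: of_nat_Suc)

lemma euler_inject: "euler p = euler q \<Longrightarrow> p = q"
proof (rule poly_mapping_eqI)
  fix \<alpha> assume "euler p = euler q"
  then have "coef (euler p) \<alpha> = coef (euler q) \<alpha>" by simp
  then show "coef p \<alpha> = coef q \<alpha>" by (simp add: coef_euler del: of_nat_Suc)
qed

definition homogeneous :: "nat \<Rightarrow> 'n::finite mpoly \<Rightarrow> bool" where
  "homogeneous n p \<longleftrightarrow> (\<forall>\<alpha>\<in>supp p. mdeg \<alpha> = n)"

lemma homogeneous_Var_mult: "homogeneous n p \<Longrightarrow> homogeneous (Suc n) (Var i * p)"
  unfolding homogeneous_def supp_Var_mult by (auto simp: mdeg_unit_idx_add)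

lemma homogeneous_Cst_mult: "homogeneous n p \<Longrightarrow> homogeneous n (Cst c * p)"
  unfolding homogeneous_def by (auto simp: in_keys_iff)

lemma homogeneous_sum: "(\<And>x. x \<in> A \<Longrightarrow> homogeneous n (f x)) \<Longrightarrow> homogeneous n (sum f A)"
  unfolding homogeneous_def using keys_sum by fastforce

lemma euler_homogeneous: "homogeneous n p \<Longrightarrow> euler p = Cst (of_nat (Suc n)) * p"
proof (rule poly_mapping_eqI)
  fix \<alpha> assume "homogeneous n p"
  then show "coef (euler p) \<alpha> = coef (Cst (of_nat (Suc n)) * p) \<alpha>"
    by (cases "\<alpha> \<in> supp p") (auto simp: homogeneous_def coef_euler in_keys_iff)
qed

definition lin_form :: "('n::finite \<Rightarrow> 'n \<Rightarrow> complex) \<Rightarrow> 'n \<Rightarrow> 'n mpoly" where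
  "lin_form u i = (\<Sum>j\<in>UNIV. Cst (u i j) * Var j)"

lemma lin_form_mult: "lin_form u i * p = (\<Sum>j\<in>UNIV. Cst (u i j) * (Var j * p))"
  by (simp add: lin_form_def sum_distrib_right mult.assoc)

lemma homogeneous_subst_monom_of: "homogeneous (mdeg \<alpha>) (subst (lin_form u) (monom_of \<alpha>))"
proof (induction \<alpha> rule: multi_index_induct)
  case zero
  have "homogeneous 0 1" by (simp add: homogeneous_def)
  then show ?case by simp
next
  case (unit i \<alpha>)
  have "monom_of (unit_idx i + \<alpha>) = Var i * monom_of \<alpha>"
    by (simp add: monom_of_add Var_def)
  then show ?case
    unfolding mdeg_unit_idx_add
    using unit by (simp only: subst_Var_mult lin_form_mult) (intro homogeneous_sum homogeneous_Cst_mult homogeneous_Var_mult)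
qed

text \<open>Linear substitutions preserve the degree, and \<open>euler\<close> is a scalar on each
  homogeneous part.\<close>

lemma euler_subst_lin_form: "euler (subst (lin_form u) p) = subst (lin_form u) (euler p)"
proof (induction p rule: mpoly_monom_induct)
  case (monom \<alpha> c)
  have "homogeneous (mdeg \<alpha>) (monom_of \<alpha>)" by (auto simp: homogeneous_def monom_of_def)
  then show ?case
    by (simp only: subst_Cst_mult euler_Cst_mult euler_homogeneous homogeneous_subst_monom_of[THEN euler_homogeneous])
qed (simp_all add: subst_add euler_add)

text \<open>The factor in \<open>bshift\<close> is exactly the quotient of the weights at
  \<open>unit_idx i + \<alpha>\<close> and at \<alpha>.\<close>

lemma h2_inner_Var_mult: "h2_inner (Var i * p) q = h2_inner p (bshift i q)"
proof -
  have inj: "inj_on (\<lambda>\<alpha>. unit_idx i + \<alpha>) (supp p)" by (auto intro: inj_onI)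
  have "h2_inner (Var i * p) q = (\<Sum>\<alpha>\<in>(\<lambda>\<alpha>. unit_idx i + \<alpha>) ` supp p. coef (Var i * p) \<alpha> * cnj (coef q \<alpha>) * of_real (h2_weight \<alpha>))"
    by (rule h2_inner_superset) (auto simp: supp_Var_mult)
  also have "\<dots> = (\<Sum>\<alpha>\<in>supp p. coef p \<alpha> * cnj (coef q (unit_idx i + \<alpha>)) * of_real (h2_weight (unit_idx i + \<alpha>)))"
    unfolding sum.reindex[OF inj] by (simp add: coef_Var_mult lookup_add)
  also have "\<dots> = (\<Sum>\<alpha>\<in>supp p. coef p \<alpha> * cnj (coef (bshift i q) \<alpha>) * of_real (h2_weight \<alpha>))"
    by (rule sum.cong) (simp_all add: coef_bshift h2_weight_unit_idx_add add.commute[of 1])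
  also have "\<dots> = h2_inner p (bshift i q)"
    by (rule h2_inner_superset[symmetric]) auto
  finally show ?thesis .
qed

lemma h2_inner_Cst_mult_left: "h2_inner (Cst c * p) q = c * h2_inner p q"
  by (simp add: Cst_def h2_inner_scale_left)

lemma h2_inner_Cst_mult_right: "h2_inner p (Cst c * q) = cnj c * h2_inner p q"
  by (subst (1 2) h2_inner_cnj[symmetric]) (simp add: h2_inner_Cst_mult_left)

lemma h2_inner_0_left [simp]: "h2_inner 0 q = 0"
  by (simp add: h2_inner_def)

lemma h2_inner_sum_left: "h2_inner (sum f A) q = (\<Sum>x\<in>A. h2_inner (f x) q)"
  by (induction A rule: infinite_finite_induct) (simp_all add: h2_inner_add_left)

lemma h2_inner_sum_right: "h2_inner p (sum f A) = (\<Sum>x\<in>A. h2_inner p (f x))"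
  by (subst h2_inner_cnj[symmetric]) (simp add: h2_inner_sum_left h2_inner_cnj)

text \<open>Hermitian involutions are general enough, since a reflection can move any point to an
  axis. They make the substitution its own inverse, so no second matrix has to be carried
  along.\<close>

locale hermitian_unitary =
  fixes u :: "'n::finite \<Rightarrow> 'n \<Rightarrow> complex"
  assumes hermitian: "cnj (u i j) = u j i"
    and square: "(\<Sum>j\<in>UNIV. u i j * u j k) = (if i = k then 1 else 0)"
begin

abbreviation rot :: "'n mpoly \<Rightarrow> 'n mpoly" where
  "rot \<equiv> subst (lin_form u)"

lemma rot_lin_form: "rot (lin_form u i) = Var i"
proof -
  have "rot (lin_form u i) = (\<Sum>j\<in>UNIV. \<Sum>k\<in>UNIV. Cst (u i j * u j k) * Var k)"
    unfolding lin_form_def[of u i] subst_sum subst_Cst_mult subst_Var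
    by (simp add: lin_form_def sum_distrib_left Cst_mult mult.assoc)
  also have "\<dots> = (\<Sum>k\<in>UNIV. Cst (\<Sum>j\<in>UNIV. u i j * u j k) * Var k)"
    by (subst sum.swap) (simp add: Cst_sum sum_distrib_right)
  also have "\<dots> = (\<Sum>k\<in>UNIV. if i = k then Var k else 0)"
    unfolding square by (rule sum.cong) auto
  finally show ?thesis by simp
qed

lemma rot_rot [simp]: "rot (rot p) = p"
  by (induction p rule: mpoly_induct) (simp_all add: subst_add subst_Var_mult subst_mult rot_lin_form subst_Var)

text \<open>The chain rule solved for the rotated derivative: it expands the derivatives of
  \<open>rot q\<close> with the entries \<open>u k j\<close>, and summation against
  \<open>u j i\<close> leaves only k = i because the matrix squares to the identity.\<close>

lemma mderiv_rot: "(\<Sum>j\<in>UNIV. Cst (u j i) * mderiv j (rot q)) = rot (mderiv i q)"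
proof (induction q rule: mpoly_induct)
  case (Cst c)
  show ?case by simp
next
  case (Var k q)
  have "mderiv j (lin_form u k * rot q) = Cst (u k j) * rot q + lin_form u k * mderiv j (rot q)" for j
  proof -
    have "mderiv j (lin_form u k * rot q)
        = (\<Sum>l\<in>UNIV. Cst (u k l) * ((if l = j then rot q else 0) + Var l * mderiv j (rot q)))"
      unfolding lin_form_mult mderiv_sum mderiv_Cst_mult mderiv_Var_mult ..
    also have "\<dots> = (\<Sum>l\<in>UNIV. if l = j then Cst (u k l) * rot q else 0) + lin_form u k * mderiv j (rot q)"
      unfolding distrib_left sum.distrib lin_form_mult
      by (rule arg_cong2[of _ _ _ _ "(+)"]) (rule sum.cong, auto simp: sum_distrib_left mult.left_commute)
    finally show ?thesis by simp
  qed
  then have "(\<Sum>j\<in>UNIV. Cst (u j i) * mderiv j (rot (Var k * q)))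
      = (\<Sum>j\<in>UNIV. Cst (u k j * u j i) * rot q + lin_form u k * (Cst (u j i) * mderiv j (rot q)))"
    unfolding subst_Var_mult by (intro sum.cong refl) (simp add: Cst_mult algebra_simps)
  also have "\<dots> = Cst (\<Sum>j\<in>UNIV. u k j * u j i) * rot q + lin_form u k * rot (mderiv i q)"
    unfolding Var[symmetric] sum.distrib by (simp add: Cst_sum sum_distrib_left sum_distrib_right)
  also have "\<dots> = rot (mderiv i (Var k * q))"
    unfolding square by (simp add: mderiv_Var_mult subst_add subst_Var_mult)
  finally show ?case .
next
  case (add p q)
  then show ?case by (simp add: subst_add mderiv_add distrib_left sum.distrib)
qed

text \<open>Applying the injective \<open>euler\<close> to both sides turns \<open>bshift\<close>
  into \<open>mderiv\<close>, where the chain rule is available.\<close>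

lemma bshift_rot: "(\<Sum>j\<in>UNIV. Cst (u j i) * bshift j (rot q)) = rot (bshift i q)"
  by (rule euler_inject) (simp add: euler_sum euler_Cst_mult euler_bshift euler_subst_lin_form mderiv_rot)

lemma coef_rot_0: "coef (rot q) 0 = coef q 0"
proof (induction q rule: mpoly_induct)
  case (Var i q)
  show ?case unfolding subst_Var_mult lin_form_mult by (simp add: lookup_sum coef_Var_mult)
qed (simp_all add: subst_add lookup_add)

text \<open>A variable in \<open>p\<close> is moved to the other side as an adjoint shift, which
  commutes with the rotation up to the matrix. What remains is a constant, which sees only the
  coefficient at 0, and this is kept by a linear substitution.\<close>

lemma h2_inner_rot: "h2_inner (rot p) (rot q) = h2_inner p q"
proof (induction p arbitrary: q rule: mpoly_induct)
  case (Cst c)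
  have "h2_inner (Cst c) r = c * cnj (coef r 0) * of_real (h2_weight (0 :: 'n \<Rightarrow>\<^sub>0 nat))" for r :: "'n mpoly"
    by (subst h2_inner_superset[of "{0}"]) (simp_all add: subset_iff in_keys_iff coef_Cst)
  then show ?case by (simp add: coef_rot_0)
next
  case (Var i p)
  have "h2_inner (rot (Var i * p)) (rot q) = (\<Sum>j\<in>UNIV. u i j * h2_inner (rot p) (bshift j (rot q)))"
    by (simp add: subst_Var_mult lin_form_mult h2_inner_sum_left h2_inner_Cst_mult_left h2_inner_Var_mult)
  also have "\<dots> = h2_inner (rot p) (\<Sum>j\<in>UNIV. Cst (u j i) * bshift j (rot q))"
    by (simp add: h2_inner_sum_right h2_inner_Cst_mult_right hermitian)
  also have "\<dots> = h2_inner (Var i * p) q"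
    by (simp add: bshift_rot Var h2_inner_Var_mult)
  finally show ?case .
next
  case (add p p')
  then show ?case by (simp add: subst_add h2_inner_add_left)
qed

lemma h2_norm_rot: "h2_norm (rot p) = h2_norm p"
  by (simp add: h2_norm_def h2_inner_rot)

lemma ideal_rot:
  assumes I: "is_ideal I"
  shows "is_ideal (rot ` I)"
  unfolding module.subspace_def[OF module_times]
proof (intro conjI ballI allI)
  have "rot 0 = 0" by simp
  then show "0 \<in> rot ` I" using ideal_0[OF I] by (metis imageI)
next
  fix x y assume "x \<in> rot ` I" "y \<in> rot ` I"
  then show "x + y \<in> rot ` I" using ideal_add[OF I] by (auto simp flip: subst_add)
next
  fix c x assume "x \<in> rot ` I"
  then obtain y where y: "x = rot y" "y \<in> I" by blast
  \<comment> \<open>The rotation is an involution, so \<open>c\<close> is the image of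
    \<open>rot c\<close>.\<close>
  then have "c * x = rot (rot c * y)" by (simp add: subst_mult)
  then show "c * x \<in> rot ` I" using ideal_mult[OF I y(2)] by (metis imageI)
qed

lemma stable_division_rot:
  assumes I: "is_ideal I" and "stable_division_property h2_norm (rot ` I)"
  shows "stable_division_property h2_norm I"
proof -
  obtain F C where F: "finite F" "F \<subseteq> rot ` I" "\<forall>h\<in>rot ` I. bdiv F (C * h2_norm h) h"
    using stable_divisionD[OF assms(2)] by blast
  have inj: "inj_on rot F" by (rule inj_on_inverseI[of _ rot]) simp
  show ?thesis
  proof (rule stable_divisionI[OF I])
    show "finite (rot ` F)" using F(1) by simp
    show "rot ` F \<subseteq> I" using F(2) by auto
    fix h assume "h \<in> I"
    then have "bdiv F (C * h2_norm (rot h)) (rot h)" using F(3) by blast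
    then obtain a where a: "rot h = (\<Sum>f\<in>F. a f * f)" "\<And>f. f \<in> F \<Longrightarrow> h2_norm (a f * f) \<le> C * h2_norm h"
      unfolding bdiv_def h2_norm_rot by blast
    have "h = rot (rot h)" by simp
    also have "\<dots> = (\<Sum>f\<in>F. rot (a f) * rot f)"
      unfolding a(1) by (simp add: subst_sum subst_mult)
    also have "\<dots> = (\<Sum>g\<in>rot ` F. rot (a (rot g)) * g)"
      unfolding sum.reindex[OF inj] by simp
    finally have "h = (\<Sum>g\<in>rot ` F. rot (a (rot g)) * g)" .
    moreover have "h2_norm (rot (a (rot g)) * g) \<le> C * h2_norm h" if g: "g \<in> rot ` F" for g
    proof -
      obtain f where f: "g = rot f" "f \<in> F" using g by blast
      have "h2_norm (rot (a (rot g)) * g) = h2_norm (rot (a f * f))"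
        by (simp add: f subst_mult)
      then show ?thesis using a(2)[OF f(2)] by (simp add: h2_norm_rot)
    qed
    ultimately show "bdiv (rot ` F) (C * h2_norm h) h"
      unfolding bdiv_def by (intro exI[of _ "\<lambda>g. rot (a (rot g))"]) blast
  qed
qed

end

text \<open>
  The witness is the Householder reflection along \<open>w = v - \<omega> \<bar>v\<bar> e\<^sub>a\<close>; if \<open>w = 0\<close>, division by zero turns
  it into the identity, which is what is needed.
\<close>

lemma householder:
  fixes v :: "'n::finite \<Rightarrow> complex" and a :: 'n
  shows "\<exists>u r. hermitian_unitary u \<and> (\<forall>j. (\<Sum>i\<in>UNIV. u j i * v i) = (if j = a then r else 0))"
proof -
  define n where "n = sqrt (\<Sum>i\<in>UNIV. (cmod (v i))\<^sup>2)"
  \<comment> \<open>The phase of \<open>v a\<close> makes the inner product of \<open>v\<close> with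
    the target vector real, as a reflection between the two requires. The value 1 keeps the modulus
    equal to 1 where \<open>sgn\<close> would give 0.\<close>
  define \<omega> where "\<omega> = (if v a = 0 then 1 else sgn (v a))"
  define w where "w i = v i - (if i = a then \<omega> * of_real n else 0)" for i
  define s where "s = (\<Sum>i\<in>UNIV. cnj (w i) * w i)"
  have "cnj \<omega> * \<omega> = 1 \<and> cnj \<omega> * v a = of_real (cmod (v a)) \<and> cnj (v a) * \<omega> = of_real (cmod (v a))"
  proof (cases "v a = 0")
    case False
    have "cnj (v a) * v a = of_real (cmod (v a)) * of_real (cmod (v a))"
      by (subst mult.commute, subst complex_norm_square[symmetric]) (simp add: power2_eq_square)
    with False show ?thesis by (simp add: \<omega>_def sgn_eq)
  qed (simp add: \<omega>_def)
  then have \<omega>: "cnj \<omega> * \<omega> = 1" "cnj \<omega> * v a = of_real (cmod (v a))" "cnj (v a) * \<omega> = of_real (cmod (v a))"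
    by auto
  have cnj_mult: "cnj z * z = of_real ((cmod z)\<^sup>2)" for z
    by (subst complex_norm_square) (rule mult.commute)
  have "n * n = (\<Sum>i\<in>UNIV. (cmod (v i))\<^sup>2)"
    unfolding n_def by (simp add: sum_nonneg)
  then have n2: "of_real n * of_real n = (\<Sum>i\<in>UNIV. cnj (v i) * v i)"
    unfolding cnj_mult by (simp only: flip: of_real_mult of_real_sum)
  have wv: "(\<Sum>i\<in>UNIV. cnj (w i) * v i) = of_real n * of_real n - of_real n * of_real (cmod (v a))"
  proof -
    have "(\<Sum>i\<in>UNIV. cnj (w i) * v i) = (\<Sum>i\<in>UNIV. cnj (v i) * v i - (if i = a then of_real n * (cnj \<omega> * v a) else 0))"
      by (rule sum.cong) (auto simp: w_def left_diff_distrib mult.assoc mult.left_commute)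
    then show ?thesis by (simp only: sum_subtractf n2 \<omega>) simp
  qed
  have "s = (\<Sum>i\<in>UNIV. cnj (w i) * v i - (if i = a then cnj (w a) * (\<omega> * of_real n) else 0))"
    unfolding s_def by (rule sum.cong) (auto simp: w_def right_diff_distrib)
  also have "\<dots> = (\<Sum>i\<in>UNIV. cnj (w i) * v i) - cnj (w a) * (\<omega> * of_real n)"
    by (simp add: sum_subtractf)
  finally have s_eq: "s = (\<Sum>i\<in>UNIV. cnj (w i) * v i) - cnj (w a) * (\<omega> * of_real n)" .
  have "cnj (w a) * (\<omega> * of_real n) = (cnj (v a) * \<omega>) * of_real n - (cnj \<omega> * \<omega>) * (of_real n * of_real n)"
    by (simp add: w_def left_diff_distrib right_diff_distrib mult_ac)
  \<comment> \<open>This identity makes the reflection send \<open>v\<close> to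
    \<open>v - w\<close>, which is the target on the axis.\<close>
  then have s: "s = 2 * (\<Sum>i\<in>UNIV. cnj (w i) * v i)"
    unfolding s_eq wv \<omega> by simp
  define u where "u i j = (if i = j then 1 else 0) - 2 * (w i * cnj (w j)) / s" for i j
  have s_cnj: "cnj s = s" by (simp add: s_def mult.commute)
  have w0: "w i = 0" if "s = 0" for i
  proof -
    have "s = of_real (\<Sum>i\<in>UNIV. (cmod (w i))\<^sup>2)"
      unfolding s_def cnj_mult by simp
    with that have "(\<Sum>i\<in>UNIV. (cmod (w i))\<^sup>2) = 0" by (metis of_real_eq_0_iff)
    then show ?thesis by (simp add: sum_nonneg_eq_0_iff)
  qed
  have "hermitian_unitary u"
  proof
    show "cnj (u i j) = u j i" for i j
      by (simp add: u_def s_cnj mult.commute)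
    fix i k
    let ?x = "w i * cnj (w k)"
    have uu: "u i j * u j k = (if i = j then u j k else 0) - (if j = k then 2 * ?x / s else 0)
        + 4 * ?x / (s * s) * (cnj (w j) * w j)" for j
    proof -
      have "(A - 2 * (a * b) / s) * (B - 2 * (c * d) / s)
          = A * (B - 2 * (c * d) / s) - B * (2 * (a * b) / s) + 4 * (a * d) / (s * s) * (b * c)" for A B a b c d
        by (simp add: left_diff_distrib right_diff_distrib mult_ac)
      from this[of "if i = j then 1 else 0" "w i" "cnj (w j)" "if j = k then 1 else 0" "w j" "cnj (w k)"]
      show ?thesis by (simp add: u_def)
    qed
    have "(\<Sum>j\<in>UNIV. u i j * u j k) = u i k - 2 * ?x / s + 4 * ?x / (s * s) * s"
      unfolding uu sum.distrib sum_subtractf sum_distrib_left[symmetric] s_def[symmetric] by simp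
    moreover have "4 * ?x / (s * s) * s = 4 * ?x / s"
      by simp
    moreover have "u i k - 2 * ?x / s + 4 * ?x / s = (if i = k then 1 else 0)"
      by (simp add: u_def)
    ultimately show "(\<Sum>j\<in>UNIV. u i j * u j k) = (if i = k then 1 else 0)"
      by (simp only:)
  qed
  moreover have "(\<Sum>i\<in>UNIV. u j i * v i) = (if j = a then \<omega> * of_real n else 0)" for j
  proof -
    have "(\<Sum>i\<in>UNIV. u j i * v i) = (\<Sum>i\<in>UNIV. (if j = i then v i else 0) - 2 * w j / s * (cnj (w i) * v i))"
      by (rule sum.cong) (auto simp: u_def left_diff_distrib)
    also have "\<dots> = v j - 2 * w j / s * (\<Sum>i\<in>UNIV. cnj (w i) * v i)"
      unfolding sum_subtractf sum_distrib_left[symmetric] by simp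
    also have "2 * w j / s * (\<Sum>i\<in>UNIV. cnj (w i) * v i) = w j / s * s"
      by (subst s) simp
    also have "w j / s * s = w j"
      using w0[of j] by (cases "s = 0") auto
    finally show ?thesis by (simp add: w_def)
  qed
  ultimately show ?thesis by blast
qed

section \<open>Division by powers of a linear polynomial\<close>

definition restr :: "('n \<Rightarrow>\<^sub>0 nat) set \<Rightarrow> 'n mpoly \<Rightarrow> 'n mpoly" where
  "restr S = Poly_Mapping.mapp (\<lambda>\<alpha> c. if \<alpha> \<in> S then c else 0)"

lemma coef_restr: "coef (restr S p) \<alpha> = (if \<alpha> \<in> S then coef p \<alpha> else 0)"
  by (simp add: restr_def lookup_mapp when_def in_keys_iff)

lemma supp_restr: "supp (restr S p) \<subseteq> S"
  by (auto simp: in_keys_iff coef_restr split: if_splits)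

lemma restr_eq: "supp p \<subseteq> S \<Longrightarrow> restr S p = p"
  by (rule poly_mapping_eqI) (auto simp: coef_restr in_keys_iff)

lemma h2_norm_restr_le: "h2_norm (restr S p) \<le> h2_norm p"
  by (rule h2_norm_mono) (simp add: coef_restr)

lemma Var_power_dvd:
  assumes "\<And>\<alpha>. \<alpha> \<in> supp p \<Longrightarrow> k \<le> coef \<alpha> j"
  shows "\<exists>q. p = q * Var j ^ k"
proof
  let ?q = "Poly_Mapping.map_key (\<lambda>\<alpha>. Poly_Mapping.single j k + \<alpha>) p"
  have q: "coef ?q \<alpha> = coef p (Poly_Mapping.single j k + \<alpha>)" for \<alpha>
    by (subst Poly_Mapping.map_key.rep_eq) (auto intro: injI)
  show "p = ?q * Var j ^ k"
  proof (rule poly_mapping_eqI)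
    fix \<alpha>
    show "coef p \<alpha> = coef (?q * Var j ^ k) \<alpha>"
    proof (cases "k \<le> coef \<alpha> j")
      case True
      then obtain \<gamma> where \<gamma>: "\<alpha> = Poly_Mapping.single j k + \<gamma>" by (rule multi_index_split)
      then show ?thesis
        using True by (simp add: mult.commute[of _ "Var j ^ k"] coef_Var_power_mult q)
    next
      case False
      then have "coef p \<alpha> = 0" using assms[of \<alpha>] by (auto simp: in_keys_iff)
      with False show ?thesis by (simp add: mult.commute[of _ "Var j ^ k"] coef_Var_power_mult)
    qed
  qed
qed

text \<open>The monomials divisible by no \<open>Var j ^ k\<close> with j different from
  \<open>a\<close>: finitely many rays in direction \<open>a\<close>.\<close>

definition cyl :: "'n \<Rightarrow> nat \<Rightarrow> ('n \<Rightarrow>\<^sub>0 nat) set" where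
  "cyl a k = {\<alpha>. \<forall>j. j \<noteq> a \<longrightarrow> coef \<alpha> j < k}"

lemma cyl_shift: "unit_idx a + \<alpha> \<in> cyl a k \<longleftrightarrow> \<alpha> \<in> cyl a k"
  by (simp add: cyl_def lookup_add lookup_single when_def)

lemma restr_Cst_mult: "restr S (Cst c * p) = Cst c * restr S p"
  by (rule poly_mapping_eqI) (simp add: coef_restr)

lemma restr_diff: "restr S (p - q) = restr S p - restr S q"
  by (rule poly_mapping_eqI) (simp add: coef_restr lookup_minus)

lemma restr_cyl_Var_mult: "restr (cyl a k) (Var a * p) = Var a * restr (cyl a k) p"
proof (rule poly_mapping_eqI)
  fix \<alpha>
  show "coef (restr (cyl a k) (Var a * p)) \<alpha> = coef (Var a * restr (cyl a k) p) \<alpha>"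
  proof (cases "coef \<alpha> a = 0")
    case True
    then show ?thesis by (simp add: coef_restr coef_Var_mult)
  next
    case False
    then obtain \<gamma> where \<gamma>: "\<alpha> = unit_idx a + \<gamma>"
      by (metis Suc_leI multi_index_split neq0_conv)
    show ?thesis by (simp add: \<gamma> coef_restr coef_Var_mult_add cyl_shift)
  qed
qed

text \<open>Each monomial outside the cylinder is charged to one chosen variable. The pieces are
  therefore restrictions of \<open>h\<close> to disjoint sets, and none of them exceeds
  \<open>h\<close> in norm.\<close>

lemma cyl_decomposition:
  fixes h :: "'n::finite mpoly"
  shows "\<exists>S. h = (\<Sum>j\<in>UNIV - {a}. restr (S j) h) + restr (cyl a k) h \<and> (\<forall>j. \<forall>\<alpha>\<in>S j. k \<le> coef \<alpha> j)"
proof -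
  define jj where "jj \<alpha> = (SOME j. j \<noteq> a \<and> k \<le> coef \<alpha> j)" for \<alpha> :: "'n \<Rightarrow>\<^sub>0 nat"
  have jj: "jj \<alpha> \<noteq> a \<and> k \<le> coef \<alpha> (jj \<alpha>)" if \<alpha>: "\<alpha> \<notin> cyl a k" for \<alpha>
    unfolding jj_def by (rule someI_ex) (use \<alpha> in \<open>auto simp: cyl_def not_less\<close>)
  define S where "S j = {\<alpha>. \<alpha> \<notin> cyl a k \<and> jj \<alpha> = j}" for j
  have "h = (\<Sum>j\<in>UNIV - {a}. restr (S j) h) + restr (cyl a k) h"
  proof (rule poly_mapping_eqI)
    fix \<alpha>
    have "(\<Sum>j\<in>UNIV - {a}. coef (restr (S j) h) \<alpha>) = (if \<alpha> \<in> cyl a k then 0 else coef h \<alpha>)"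
    proof (cases "\<alpha> \<in> cyl a k")
      case True
      then show ?thesis by (simp add: coef_restr S_def)
    next
      case False
      have "(\<Sum>j\<in>UNIV - {a}. coef (restr (S j) h) \<alpha>) = (\<Sum>j\<in>UNIV - {a}. if j = jj \<alpha> then coef h \<alpha> else 0)"
        by (rule sum.cong) (use False in \<open>auto simp: coef_restr S_def\<close>)
      then show ?thesis using False jj[OF False] by simp
    qed
    then show "coef h \<alpha> = coef ((\<Sum>j\<in>UNIV - {a}. restr (S j) h) + restr (cyl a k) h) \<alpha>"
      by (simp add: lookup_add lookup_sum coef_restr)
  qed
  moreover have "\<forall>j. \<forall>\<alpha>\<in>S j. k \<le> coef \<alpha> j"
    using jj by (auto simp: S_def)
  ultimately show ?thesis by blast
qed

text \<open>
  A weighted \<open>\<ell>\<^sup>1\<close> norm for which division by \<open>z\<^sub>a - r\<close> with \<open>\<bar>r\<bar> < \<rho>\<close> is bounded.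
\<close>

definition wnorm :: "'n \<Rightarrow> real \<Rightarrow> 'n mpoly \<Rightarrow> real" where
  "wnorm a \<rho> p = (\<Sum>\<alpha>\<in>supp p. cmod (coef p \<alpha>) * \<rho> ^ coef \<alpha> a)"

lemma wnorm_superset:
  assumes "finite A" "supp p \<subseteq> A"
  shows "wnorm a \<rho> p = (\<Sum>\<alpha>\<in>A. cmod (coef p \<alpha>) * \<rho> ^ coef \<alpha> a)"
  unfolding wnorm_def by (rule sum.mono_neutral_left) (use assms in \<open>auto simp: in_keys_iff\<close>)

lemma wnorm_triangle:
  assumes "0 \<le> \<rho>"
  shows "wnorm a \<rho> (p + q) \<le> wnorm a \<rho> p + wnorm a \<rho> q"
proof -
  let ?A = "supp p \<union> supp q"
  have A: "finite ?A" "supp p \<subseteq> ?A" "supp q \<subseteq> ?A" "supp (p + q) \<subseteq> ?A"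
    by (auto simp: in_keys_iff lookup_add)
  have "(\<Sum>\<alpha>\<in>?A. cmod (coef (p + q) \<alpha>) * \<rho> ^ coef \<alpha> a)
      \<le> (\<Sum>\<alpha>\<in>?A. (cmod (coef p \<alpha>) + cmod (coef q \<alpha>)) * \<rho> ^ coef \<alpha> a)"
    by (intro sum_mono mult_right_mono) (use assms in \<open>auto simp: lookup_add norm_triangle_ineq\<close>)
  then show ?thesis
    unfolding wnorm_superset[OF A(1,2)] wnorm_superset[OF A(1,3)] wnorm_superset[OF A(1,4)]
    by (simp add: distrib_right sum.distrib)
qed

lemma wnorm_Cst_mult: "wnorm a \<rho> (Cst c * p) = cmod c * wnorm a \<rho> p"
proof -
  have "supp (Cst c * p) \<subseteq> supp p" by (auto simp: in_keys_iff)
  then show ?thesis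
    by (simp add: wnorm_superset[of "supp p"] norm_mult sum_distrib_left mult.assoc)
qed

lemma wnorm_Var_mult: "wnorm a \<rho> (Var a * p) = \<rho> * wnorm a \<rho> p"
proof -
  have inj: "inj_on (\<lambda>\<alpha>. unit_idx a + \<alpha>) (supp p)" by (auto intro: inj_onI)
  show ?thesis
    unfolding wnorm_def supp_Var_mult sum.reindex[OF inj] o_def coef_Var_mult_add
    by (simp add: lookup_add sum_distrib_left mult.left_commute)
qed

lemma wnorm_monom_of: "wnorm a \<rho> (monom_of \<alpha>) = \<rho> ^ coef \<alpha> a"
  by (simp add: wnorm_def monom_of_def)

lemma wnorm_nonneg: "0 \<le> \<rho> \<Longrightarrow> 0 \<le> wnorm a \<rho> p"
  unfolding wnorm_def by (rule sum_nonneg) simp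

lemma wnorm_0 [simp]: "wnorm a \<rho> 0 = 0"
  by (simp add: wnorm_def)

lemma wnorm_minus [simp]: "wnorm a \<rho> (- p) = wnorm a \<rho> p"
proof -
  have "supp (- p) \<subseteq> supp p" by (auto simp: in_keys_iff)
  then show ?thesis by (simp add: wnorm_superset[of "supp p"])
qed

lemma wnorm_triangle_diff: "0 \<le> \<rho> \<Longrightarrow> wnorm a \<rho> (p - q) \<le> wnorm a \<rho> p + wnorm a \<rho> q"
  using wnorm_triangle[of \<rho> a p "- q"] by simp

lemma wnorm_sum_le: "0 \<le> \<rho> \<Longrightarrow> wnorm a \<rho> (sum f A) \<le> (\<Sum>x\<in>A. wnorm a \<rho> (f x))"
proof (induction A rule: infinite_finite_induct)
  case (insert x A)
  then show ?case using wnorm_triangle[of \<rho> a "f x" "sum f A"] by simp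
qed auto

lemma coef_le_wnorm: "0 \<le> \<rho> \<Longrightarrow> cmod (coef p \<alpha>) * \<rho> ^ coef \<alpha> a \<le> wnorm a \<rho> p"
  using wnorm_nonneg[of \<rho> a p]
  by (cases "\<alpha> \<in> supp p") (auto simp: in_keys_iff wnorm_def intro!: member_le_sum[of \<alpha> _ "\<lambda>\<alpha>. cmod (coef p \<alpha>) * \<rho> ^ coef \<alpha> a"])

text \<open>Multiplication by z_a scales this norm by exactly \<rho>, multiplication by
  \<open>r\<close> only by |r|; the triangle inequality gives the gap.\<close>

lemma wnorm_linear_mult_ge:
  assumes "0 \<le> \<rho>"
  shows "(\<rho> - cmod r) * wnorm a \<rho> q \<le> wnorm a \<rho> ((Var a - Cst r) * q)"
proof -
  have "Var a * q = (Var a - Cst r) * q + Cst r * q" by (simp add: algebra_simps)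
  then have "\<rho> * wnorm a \<rho> q \<le> wnorm a \<rho> ((Var a - Cst r) * q) + cmod r * wnorm a \<rho> q"
    using wnorm_triangle[OF assms] by (metis wnorm_Var_mult wnorm_Cst_mult)
  then show ?thesis by (simp add: algebra_simps)
qed

section \<open>Division with remainder\<close>

definition spec :: "'n::finite \<Rightarrow> complex \<Rightarrow> 'n mpoly \<Rightarrow> 'n mpoly" where
  "spec a r = subst (\<lambda>i. if i = a then Cst r else Var i)"

lemma spec_dvd: "\<exists>q. p = spec a r p + (Var a - Cst r) * q"
proof (induction p rule: mpoly_induct)
  case (Cst c)
  show ?case by (intro exI[of _ 0]) (simp add: spec_def)
next
  case (Var i p)
  then obtain q where q: "p = spec a r p + (Var a - Cst r) * q" by blast
  show ?case
  proof (cases "i = a")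
    case True
    \<comment> \<open>From z_a p = (z_a - r) p + r p, with the known quotient used in the second
      summand.\<close>
    have "Var a * p = Cst r * spec a r p + (Var a - Cst r) * (p + Cst r * q)"
      by (subst (1) q, subst (3) q) (simp add: algebra_simps)
    moreover have "spec a r (Var i * p) = Cst r * spec a r p"
      using True by (simp add: spec_def subst_Var_mult)
    ultimately show ?thesis using True by metis
  next
    case False
    have "Var i * p = Var i * spec a r p + (Var a - Cst r) * (Var i * q)"
      by (subst (1) q) (simp add: algebra_simps)
    moreover have "spec a r (Var i * p) = Var i * spec a r p"
      using False by (simp add: spec_def subst_Var_mult)
    ultimately show ?thesis by metis
  qed
next
  case (add p p')
  then obtain q q' where "p = spec a r p + (Var a - Cst r) * q" "p' = spec a r p' + (Var a - Cst r) * q'" by blast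
  then have "p + p' = (spec a r p + (Var a - Cst r) * q) + (spec a r p' + (Var a - Cst r) * q')"
    by (rule arg_cong2)
  also have "\<dots> = spec a r (p + p') + (Var a - Cst r) * (q + q')"
    by (simp add: spec_def subst_add algebra_simps)
  finally have "p + p' = spec a r (p + p') + (Var a - Cst r) * (q + q')" .
  then show ?case by blast
qed

lemma spec_monom_of:
  "spec a r (monom_of \<alpha>) = Cst (r ^ coef \<alpha> a) * monom_of (\<alpha> - Poly_Mapping.single a (coef \<alpha> a))"
proof (induction \<alpha> rule: multi_index_induct)
  case zero
  show ?case by (simp add: spec_def)
next
  case (unit i \<alpha>)
  have *: "monom_of (unit_idx i + \<alpha>) = Var i * monom_of \<alpha>"
    by (simp add: monom_of_add Var_def)
  have "spec a r (monom_of (unit_idx i + \<alpha>)) = (if i = a then Cst r else Var i) * spec a r (monom_of \<alpha>)"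
    unfolding * by (simp add: spec_def subst_Var_mult)
  also have "\<dots> = Cst (r ^ coef (unit_idx i + \<alpha>) a) * monom_of (unit_idx i + \<alpha> - Poly_Mapping.single a (coef (unit_idx i + \<alpha>) a))"
  proof (cases "i = a")
    case True
    have "unit_idx a + \<alpha> - Poly_Mapping.single a (Suc (coef \<alpha> a)) = \<alpha> - Poly_Mapping.single a (coef \<alpha> a)"
      by (rule poly_mapping_eqI) (auto simp: lookup_add lookup_minus lookup_single when_def)
    then show ?thesis using True unit by (simp add: lookup_add Cst_mult mult.assoc)
  next
    case False
    have "unit_idx i + \<alpha> - Poly_Mapping.single a (coef \<alpha> a) = unit_idx i + (\<alpha> - Poly_Mapping.single a (coef \<alpha> a))"
      using False by (intro poly_mapping_eqI) (auto simp: lookup_add lookup_minus lookup_single when_def)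
    then show ?thesis using False unit by (simp add: lookup_add lookup_single Var_def monom_of_add mult.left_commute)
  qed
  finally show ?case .
qed

lemma spec_sum:
  "spec a r p = (\<Sum>\<alpha>\<in>supp p. Cst (coef p \<alpha> * r ^ coef \<alpha> a) * monom_of (\<alpha> - Poly_Mapping.single a (coef \<alpha> a)))"
proof -
  have "spec a r p = spec a r (\<Sum>\<alpha>\<in>supp p. Cst (coef p \<alpha>) * monom_of \<alpha>)"
    using mpoly_sum_monom_of[of p] by (rule arg_cong)
  also have "\<dots> = (\<Sum>\<alpha>\<in>supp p. Cst (coef p \<alpha>) * spec a r (monom_of \<alpha>))"
    unfolding spec_def subst_sum subst_Cst_mult ..
  finally show ?thesis unfolding spec_monom_of by (simp add: Cst_mult mult.assoc)
qed

lemma supp_spec: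
  assumes "supp p \<subseteq> cyl a k"
  shows "supp (spec a r p) \<subseteq> cyl a k \<inter> {\<alpha>. coef \<alpha> a = 0}"
proof
  fix \<beta> assume "\<beta> \<in> supp (spec a r p)"
  then have "\<beta> \<in> (\<Union>\<alpha>\<in>supp p. supp (Cst (coef p \<alpha> * r ^ coef \<alpha> a) * monom_of (\<alpha> - Poly_Mapping.single a (coef \<alpha> a))))"
    unfolding spec_sum using keys_sum by (rule rev_subsetD)
  then obtain \<alpha> where \<alpha>: "\<alpha> \<in> supp p" "\<beta> = \<alpha> - Poly_Mapping.single a (coef \<alpha> a)"
    by (auto simp: in_keys_iff[of \<beta>] coef_monom_of split: if_splits)
  then show "\<beta> \<in> cyl a k \<inter> {\<alpha>. coef \<alpha> a = 0}"
    using assms by (auto simp: cyl_def lookup_minus lookup_single when_def)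
qed

lemma wnorm_spec_le:
  assumes "cmod r \<le> \<rho>"
  shows "wnorm a \<rho> (spec a r p) \<le> wnorm a \<rho> p"
proof -
  have \<rho>: "0 \<le> \<rho>" using assms norm_ge_zero[of r] by linarith
  have "wnorm a \<rho> (spec a r p) \<le> (\<Sum>\<alpha>\<in>supp p. wnorm a \<rho> (Cst (coef p \<alpha> * r ^ coef \<alpha> a) * monom_of (\<alpha> - Poly_Mapping.single a (coef \<alpha> a))))"
    unfolding spec_sum using \<rho> by (rule wnorm_sum_le)
  also have "\<dots> = (\<Sum>\<alpha>\<in>supp p. cmod (coef p \<alpha>) * cmod r ^ coef \<alpha> a)"
    by (simp add: wnorm_Cst_mult wnorm_monom_of norm_mult norm_power lookup_minus)
  also have "\<dots> \<le> wnorm a \<rho> p"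
    unfolding wnorm_def by (intro sum_mono mult_left_mono power_mono assms) auto
  finally show ?thesis .
qed

text \<open>One division by the linear factor leaves the remainder \<open>spec a r p\<close>; its
  quotient is divided by the k-th power, and the remainder of that division returns multiplied by
  the linear factor.\<close>

lemma division_linear_power:
  fixes a :: "'n::finite"
  assumes r: "cmod r < \<rho>"
  shows "\<exists>C\<ge>0. \<forall>p. supp p \<subseteq> cyl a K \<longrightarrow> (\<exists>v q. p = v + (Var a - Cst r) ^ k * q \<and>
    supp v \<subseteq> cyl a K \<inter> {\<alpha>. coef \<alpha> a < k} \<and> wnorm a \<rho> v \<le> C * wnorm a \<rho> p)"
proof (induction k)
  case 0
  show ?case by (intro exI[of _ 0]) auto
next
  case (Suc k)
  then obtain C where C: "C \<ge> 0" "\<And>p. supp p \<subseteq> cyl a K \<Longrightarrow> \<exists>v q. p = v + (Var a - Cst r) ^ k * q \<and>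
    supp v \<subseteq> cyl a K \<inter> {\<alpha>. coef \<alpha> a < k} \<and> wnorm a \<rho> v \<le> C * wnorm a \<rho> p" by blast
  have \<rho>: "0 \<le> \<rho>" using r norm_ge_zero[of r] by linarith
  \<comment> \<open>The numerator counts \<open>p\<close> and \<open>spec a r p\<close>, each of
    norm at most that of \<open>p\<close>; the denominator comes from
    \<open>wnorm_linear_mult_ge\<close>.\<close>
  define D where "D = 2 / (\<rho> - cmod r)"
  have D: "0 \<le> D" using r by (simp add: D_def)
  show ?case
  proof (rule exI[of _ "1 + (\<rho> + cmod r) * (C * D)"], intro conjI allI impI)
    show "0 \<le> 1 + (\<rho> + cmod r) * (C * D)" using \<rho> C D by simp
    fix p :: "'n mpoly" assume p: "supp p \<subseteq> cyl a K"
    obtain q where q: "p = spec a r p + (Var a - Cst r) * q" using spec_dvd by blast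
    \<comment> \<open>\<open>spec_dvd\<close> says nothing about the support of its quotient.
      Restriction to the cylinder commutes with multiplication by the linear factor and fixes
      \<open>p - spec a r p\<close>, so the restricted polynomial is a quotient as well.\<close>
    define q1 where "q1 = restr (cyl a K) q"
    have s: "supp (spec a r p) \<subseteq> cyl a K" using supp_spec[OF p] by blast
    have "(Var a - Cst r) * q1 = restr (cyl a K) ((Var a - Cst r) * q)"
      by (simp add: q1_def left_diff_distrib restr_diff restr_cyl_Var_mult restr_Cst_mult)
    also have "(Var a - Cst r) * q = p - spec a r p" using q by (metis add_diff_cancel_left')
    also have "restr (cyl a K) (p - spec a r p) = p - spec a r p"
      unfolding restr_diff restr_eq[OF p] restr_eq[OF s] ..
    finally have q1: "(Var a - Cst r) * q1 = p - spec a r p" .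
    have "(\<rho> - cmod r) * wnorm a \<rho> q1 \<le> wnorm a \<rho> p + wnorm a \<rho> (spec a r p)"
      using wnorm_linear_mult_ge[OF \<rho>, of r a q1] wnorm_triangle_diff[OF \<rho>, of a p "spec a r p"]
      unfolding q1 by linarith
    also have "\<dots> \<le> 2 * wnorm a \<rho> p"
      using wnorm_spec_le[of r \<rho> a p] r by simp
    finally have Nq1: "wnorm a \<rho> q1 \<le> D * wnorm a \<rho> p"
      using r by (simp add: D_def field_simps)
    obtain v1 q2 where v1: "q1 = v1 + (Var a - Cst r) ^ k * q2"
      "supp v1 \<subseteq> cyl a K \<inter> {\<alpha>. coef \<alpha> a < k}" "wnorm a \<rho> v1 \<le> C * wnorm a \<rho> q1"
      using C(2)[of q1] supp_restr[of "cyl a K" q] unfolding q1_def by blast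
    define v where "v = spec a r p + (Var a * v1 - Cst r * v1)"
    have "p = spec a r p + (Var a - Cst r) * q1" by (simp add: q1)
    also have "\<dots> = v + (Var a - Cst r) ^ Suc k * q2"
      unfolding v1(1) v_def by (simp add: algebra_simps)
    finally have "p = v + (Var a - Cst r) ^ Suc k * q2" .
    moreover have "supp v \<subseteq> cyl a K \<inter> {\<alpha>. coef \<alpha> a < Suc k}"
    proof
      fix \<alpha> assume "\<alpha> \<in> supp v"
      then have "\<alpha> \<in> supp (spec a r p) \<or> \<alpha> \<in> supp (Var a * v1) \<or> \<alpha> \<in> supp v1"
        by (auto simp: v_def in_keys_iff lookup_add lookup_minus)
      then show "\<alpha> \<in> cyl a K \<inter> {\<alpha>. coef \<alpha> a < Suc k}"
      proof (elim disjE)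
        assume "\<alpha> \<in> supp (spec a r p)"
        then show ?thesis using supp_spec[OF p, of r] by auto
      next
        assume "\<alpha> \<in> supp (Var a * v1)"
        then obtain \<gamma> where "\<alpha> = unit_idx a + \<gamma>" "\<gamma> \<in> supp v1" unfolding supp_Var_mult by blast
        then show ?thesis using v1(2) by (auto simp: cyl_shift lookup_add)
      next
        assume "\<alpha> \<in> supp v1"
        then show ?thesis using v1(2) by auto
      qed
    qed
    moreover have "wnorm a \<rho> v \<le> (1 + (\<rho> + cmod r) * (C * D)) * wnorm a \<rho> p"
    proof -
      have "wnorm a \<rho> v \<le> wnorm a \<rho> (spec a r p) + (wnorm a \<rho> (Var a * v1) + wnorm a \<rho> (Cst r * v1))"
        unfolding v_def using wnorm_triangle[OF \<rho>] wnorm_triangle_diff[OF \<rho>]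
        by (meson add_left_mono order_trans)
      also have "\<dots> \<le> wnorm a \<rho> p + (\<rho> + cmod r) * wnorm a \<rho> v1"
        using wnorm_spec_le[of r \<rho> a p] r by (simp add: wnorm_Var_mult wnorm_Cst_mult distrib_right)
      also have "\<dots> \<le> wnorm a \<rho> p + (\<rho> + cmod r) * (C * (D * wnorm a \<rho> p))"
        by (intro add_left_mono mult_left_mono order_trans[OF v1(3)] Nq1) (use \<rho> C in auto)
      finally show ?thesis by (simp add: algebra_simps)
    qed
    ultimately show "\<exists>v q. p = v + (Var a - Cst r) ^ Suc k * q \<and>
        supp v \<subseteq> cyl a K \<inter> {\<alpha>. coef \<alpha> a < Suc k} \<and> wnorm a \<rho> v \<le> (1 + (\<rho> + cmod r) * (C * D)) * wnorm a \<rho> p"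
      by blast
  qed
qed

text \<open>Successive weights on the ray have quotients tending to 1, so these exceed \<tau> from
  some \<open>n0\<close> on; the initial segment is absorbed into the constant.\<close>

lemma h2_weight_geometric_lower:
  fixes \<beta> :: "'n::finite \<Rightarrow>\<^sub>0 nat"
  assumes \<tau>: "0 < \<tau>" "\<tau> < 1"
  shows "\<exists>c>0. \<forall>n. c * \<tau> ^ n \<le> h2_weight (Poly_Mapping.single a n + \<beta>)"
proof -
  define x where "x n = h2_weight (Poly_Mapping.single a n + \<beta>)" for n
  have x_Suc: "x (Suc n) = x n * (real (n + coef \<beta> a) + 1) / (real (n + mdeg \<beta>) + 1)" for n
  proof -
    have *: "Poly_Mapping.single a (Suc n) + \<beta> = unit_idx a + (Poly_Mapping.single a n + \<beta>)"
      by (rule poly_mapping_eqI) (simp add: lookup_add lookup_single when_def)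
    show ?thesis
      unfolding x_def * h2_weight_unit_idx_add
      by (simp add: lookup_add sum.distrib lookup_single when_def)
  qed
  have x_pos: "0 < x n" for n by (simp add: x_def h2_weight_pos)
  \<comment> \<open>The threshold solves \<tau> (n + |\<beta>| + 1) <= n + 1, with |\<beta>| the
    total degree, after \<tau> on the left has been bounded by 1.\<close>
  obtain n0 :: nat where n0: "\<tau> * real (mdeg \<beta>) / (1 - \<tau>) \<le> real n0"
    using real_arch_simple by blast
  have x_ge: "\<tau> * x n \<le> x (Suc n)" if "n0 \<le> n" for n
  proof -
    have "\<tau> * real (mdeg \<beta>) / (1 - \<tau>) \<le> real n" using n0 that by linarith
    then have "\<tau> * real (mdeg \<beta>) \<le> real n * (1 - \<tau>)"
      using \<tau> by (simp add: divide_le_eq)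
    then have "\<tau> * (real (n + mdeg \<beta>) + 1) \<le> real (n + coef \<beta> a) + 1"
      using \<tau> by (simp add: algebra_simps)
    moreover have "0 < real (n + mdeg \<beta>) + 1" by linarith
    ultimately have "\<tau> \<le> (real (n + coef \<beta> a) + 1) / (real (n + mdeg \<beta>) + 1)"
      by (simp only: pos_le_divide_eq)
    then have "\<tau> * x n \<le> (real (n + coef \<beta> a) + 1) / (real (n + mdeg \<beta>) + 1) * x n"
      using x_pos[of n] by (intro mult_right_mono) auto
    then show ?thesis unfolding x_Suc by (simp add: mult.commute)
  qed
  define c where "c = Min ((\<lambda>n. x n / \<tau> ^ n) ` {..n0})"
  have c_pos: "0 < c" unfolding c_def using x_pos \<tau> by (subst Min_gr_iff) auto
  have c_le: "c * \<tau> ^ n \<le> x n" if "n \<le> n0" for n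
  proof -
    have "c \<le> x n / \<tau> ^ n" unfolding c_def using that by (intro Min_le) auto
    then show ?thesis using \<tau> by (simp add: pos_le_divide_eq)
  qed
  have "c * \<tau> ^ n \<le> x n" for n
  proof (cases "n \<le> n0")
    case False
    then have "n0 \<le> n" by simp
    then show ?thesis
    proof (induction n rule: dec_induct)
      case base
      show ?case by (rule c_le) simp
    next
      case (step n)
      have "c * \<tau> ^ Suc n = \<tau> * (c * \<tau> ^ n)" by simp
      also have "\<dots> \<le> \<tau> * x n" using step \<tau> by (intro mult_left_mono) auto
      also have "\<dots> \<le> x (Suc n)" using step by (intro x_ge)
      finally show ?case .
    qed
  qed (rule c_le)
  then show ?thesis using c_pos unfolding x_def by blast
qed

text \<open>The starting points of the rays that make up the cylinder.\<close>

definition base_idx :: "'n::finite \<Rightarrow> nat \<Rightarrow> ('n \<Rightarrow>\<^sub>0 nat) set" where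
  "base_idx a K = cyl a K \<inter> {\<alpha>. coef \<alpha> a = 0}"

lemma finite_base_idx: "finite (base_idx a K)"
  \<comment> \<open>\<open>Suc K\<close> because the exponent 0 at \<open>a\<close> must stay below
    the bound even for \<open>K = 0\<close>.\<close>
  by (rule finite_subset[OF _ finite_multi_index_less[of "Suc K"]])
     (auto simp: base_idx_def cyl_def less_Suc_eq, metis gr0I)

lemma cyl_split:
  assumes "\<alpha> \<in> cyl a K"
  shows "\<alpha> - Poly_Mapping.single a (coef \<alpha> a) \<in> base_idx a K"
    and "\<alpha> = Poly_Mapping.single a (coef \<alpha> a) + (\<alpha> - Poly_Mapping.single a (coef \<alpha> a))"
proof -
  have "coef (\<alpha> - Poly_Mapping.single a (coef \<alpha> a)) j = (if j = a then 0 else coef \<alpha> j)" for j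
    by (simp add: lookup_minus lookup_single)
  then show "\<alpha> - Poly_Mapping.single a (coef \<alpha> a) \<in> base_idx a K"
    using assms by (simp add: base_idx_def cyl_def)
  obtain \<gamma> where "\<alpha> = Poly_Mapping.single a (coef \<alpha> a) + \<gamma>"
    by (rule multi_index_split[OF order_refl])
  then show "\<alpha> = Poly_Mapping.single a (coef \<alpha> a) + (\<alpha> - Poly_Mapping.single a (coef \<alpha> a))"
    by (metis add_diff_cancel_left')
qed

lemma h2_weight_cyl_lower:
  fixes a :: "'n::finite"
  assumes \<tau>: "0 < \<tau>" "\<tau> < 1"
  shows "\<exists>c>0. \<forall>\<alpha>\<in>cyl a K. c * \<tau> ^ coef \<alpha> a \<le> h2_weight \<alpha>"
proof -
  have "\<exists>c. \<forall>\<beta> :: 'n \<Rightarrow>\<^sub>0 nat. 0 < c \<beta> \<and> (\<forall>n. c \<beta> * \<tau> ^ n \<le> h2_weight (Poly_Mapping.single a n + \<beta>))"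
    using h2_weight_geometric_lower[OF \<tau>, of a] by (intro choice) auto
  then obtain c where c: "\<And>\<beta> :: 'n \<Rightarrow>\<^sub>0 nat. 0 < c \<beta>" "\<And>\<beta> n. c \<beta> * \<tau> ^ n \<le> h2_weight (Poly_Mapping.single a n + \<beta>)"
    by blast
  \<comment> \<open>The element 1 keeps the minimum defined when \<open>base_idx a K\<close> is
    empty.\<close>
  define m where "m = Min (insert 1 (c ` base_idx a K))"
  have "0 < m" unfolding m_def using c(1) finite_base_idx by (subst Min_gr_iff) auto
  moreover have "m * \<tau> ^ coef \<alpha> a \<le> h2_weight \<alpha>" if "\<alpha> \<in> cyl a K" for \<alpha>
  proof -
    let ?\<beta> = "\<alpha> - Poly_Mapping.single a (coef \<alpha> a)"
    have "m \<le> c ?\<beta>"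
      unfolding m_def using cyl_split(1)[OF that] finite_base_idx by (intro Min_le) auto
    then have "m * \<tau> ^ coef \<alpha> a \<le> c ?\<beta> * \<tau> ^ coef \<alpha> a"
      using \<tau> by (intro mult_right_mono) auto
    also have "\<dots> \<le> h2_weight \<alpha>"
      using c(2)[of ?\<beta> "coef \<alpha> a"] cyl_split(2)[OF that] by simp
    finally show ?thesis .
  qed
  ultimately show ?thesis by blast
qed

text \<open>Splitting off the exponent of \<open>a\<close> embeds \<open>A\<close> into the product
  of \<open>base_idx a K\<close> with an interval, so each starting point contributes at most one
  geometric series.\<close>

lemma sum_geometric_cyl:
  fixes t :: real
  assumes t: "0 \<le> t" "t < 1" and A: "finite A" "A \<subseteq> cyl a K"
  shows "(\<Sum>\<alpha>\<in>A. t ^ coef \<alpha> a) \<le> real (card (base_idx a K)) / (1 - t)"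
proof -
  obtain M where M: "\<And>\<alpha>. \<alpha> \<in> A \<Longrightarrow> coef \<alpha> a < M"
    using multi_index_bounded[OF A(1)] by blast
  let ?\<phi> = "\<lambda>\<alpha>. (\<alpha> - Poly_Mapping.single a (coef \<alpha> a), coef \<alpha> a)"
  have inj: "inj_on ?\<phi> A"
  proof (rule inj_onI)
    fix \<alpha> \<beta> assume *: "\<alpha> \<in> A" "\<beta> \<in> A" "?\<phi> \<alpha> = ?\<phi> \<beta>"
    have "\<alpha> = Poly_Mapping.single a (coef \<alpha> a) + (\<alpha> - Poly_Mapping.single a (coef \<alpha> a))"
      by (rule cyl_split(2)) (use * A in blast)
    also have "\<dots> = Poly_Mapping.single a (coef \<beta> a) + (\<beta> - Poly_Mapping.single a (coef \<beta> a))"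
      using *(3) unfolding prod.inject by (elim conjE) (rule arg_cong2[of _ _ _ _ "(+)"], simp only:)
    also have "\<dots> = \<beta>"
      by (rule cyl_split(2)[symmetric]) (use * A in blast)
    finally show "\<alpha> = \<beta>" .
  qed
  have "(\<Sum>\<alpha>\<in>A. t ^ coef \<alpha> a) = (\<Sum>x\<in>?\<phi> ` A. t ^ snd x)"
    by (simp add: sum.reindex[OF inj])
  also have "\<dots> \<le> (\<Sum>x\<in>base_idx a K \<times> {..<M}. t ^ snd x)"
    using A M t by (intro sum_mono2) (auto simp: finite_base_idx intro!: cyl_split(1))
  also have "\<dots> = (\<Sum>\<beta>\<in>base_idx a K. \<Sum>n<M. t ^ n)"
    unfolding sum.cartesian_product by (rule sum.cong) auto
  also have "\<dots> = real (card (base_idx a K)) * ((1 - t ^ M) / (1 - t))"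
    using t by (simp add: sum_gp_strict)
  also have "\<dots> \<le> real (card (base_idx a K)) * (1 / (1 - t))"
    using t by (intro mult_left_mono divide_right_mono) auto
  finally show ?thesis by simp
qed

text \<open>The factor \<rho>^n is split into two powers of its square root \<tau>: one is paid for
  by the lower bound on the weights, the other leaves a summable geometric series.\<close>

lemma wnorm_le_h2_norm:
  fixes a :: "'n::finite"
  assumes \<rho>: "0 < \<rho>" "\<rho> < 1"
  shows "\<exists>C\<ge>0. \<forall>p. supp p \<subseteq> cyl a K \<longrightarrow> wnorm a \<rho> p \<le> C * h2_norm p"
proof -
  define \<tau> where "\<tau> = sqrt \<rho>"
  have \<tau>: "0 < \<tau>" "\<tau> < 1" "\<rho> = \<tau> * \<tau>" using \<rho> by (auto simp: \<tau>_def)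
  obtain c where c: "c > 0" "\<And>\<alpha>. \<alpha> \<in> cyl a K \<Longrightarrow> c * \<tau> ^ coef \<alpha> a \<le> h2_weight \<alpha>"
    using h2_weight_cyl_lower[OF \<tau>(1,2)] by blast
  let ?S = "real (card (base_idx a K)) / (1 - \<tau>)"
  show ?thesis
  proof (rule exI[of _ "?S / c"], intro conjI allI impI)
    show "0 \<le> ?S / c" using \<tau> c by simp
    fix p :: "'n mpoly" assume p: "supp p \<subseteq> cyl a K"
    have le: "cmod (coef p \<alpha>) * \<rho> ^ coef \<alpha> a \<le> h2_norm p / c * \<tau> ^ coef \<alpha> a" if "\<alpha> \<in> supp p" for \<alpha>
    proof -
      \<comment> \<open>The weights are at most 1, so their lower bound also bounds the square roots
        from below.\<close>
      have "h2_weight \<alpha> \<le> sqrt (h2_weight \<alpha>)"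
        using h2_weight_le_1[of \<alpha>] h2_weight_pos[of \<alpha>] by (intro real_le_rsqrt) (simp add: power2_eq_square mult_left_le)
      then have "c * \<tau> ^ coef \<alpha> a \<le> sqrt (h2_weight \<alpha>)"
        using c(2)[of \<alpha>] p that by (meson order_trans subsetD)
      then have "cmod (coef p \<alpha>) * (c * \<tau> ^ coef \<alpha> a) \<le> cmod (coef p \<alpha>) * sqrt (h2_weight \<alpha>)"
        by (rule mult_left_mono) simp
      also have "\<dots> \<le> h2_norm p" by (rule coef_le_h2_norm)
      finally have "cmod (coef p \<alpha>) * \<tau> ^ coef \<alpha> a \<le> h2_norm p / c"
        using c(1) by (simp add: pos_le_divide_eq mult.assoc mult.commute[of c])
      then have "cmod (coef p \<alpha>) * \<tau> ^ coef \<alpha> a * \<tau> ^ coef \<alpha> a \<le> h2_norm p / c * \<tau> ^ coef \<alpha> a"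
        using \<tau> by (intro mult_right_mono) auto
      then show ?thesis unfolding \<tau>(3) power_mult_distrib by (simp add: mult.assoc)
    qed
    have "wnorm a \<rho> p \<le> (\<Sum>\<alpha>\<in>supp p. h2_norm p / c * \<tau> ^ coef \<alpha> a)"
      unfolding wnorm_def by (rule sum_mono) (rule le)
    also have "\<dots> = h2_norm p / c * (\<Sum>\<alpha>\<in>supp p. \<tau> ^ coef \<alpha> a)"
      by (simp add: sum_distrib_left)
    also have "\<dots> \<le> h2_norm p / c * ?S"
      using \<tau> c p by (intro mult_left_mono sum_geometric_cyl) auto
    finally show "wnorm a \<rho> p \<le> ?S / c * h2_norm p"
      by (simp add: mult.commute)
  qed
qed

text \<open>Elimination gives an echelon basis of the members of \<open>I\<close> supported in
  \<open>S\<close>. Coordinates are read off by successive subtraction, so explicit bounds replace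
  the equivalence of norms in finite dimension.\<close>

lemma bounded_coordinates:
  fixes I :: "'n mpoly set"
  assumes I: "is_ideal I" and "finite S"
  shows "\<exists>G C. finite G \<and> (\<forall>g\<in>G. g \<in> I \<and> supp g \<subseteq> S) \<and> C \<ge> 0 \<and>
    (\<forall>v M. v \<in> I \<longrightarrow> supp v \<subseteq> S \<longrightarrow> (\<forall>\<alpha>. cmod (coef v \<alpha>) \<le> M) \<longrightarrow>
       (\<exists>c. v = (\<Sum>g\<in>G. Cst (c g) * g) \<and> (\<forall>g\<in>G. cmod (c g) \<le> C * M)))"
  using \<open>finite S\<close>
proof induction
  case empty
  show ?case
    by (rule exI[of _ "{}"], rule exI[of _ 0]) (simp add: keys_eq_empty)
next
  case (insert \<alpha> S)
  from insert.IH obtain G C where G: "finite G" "\<forall>g\<in>G. g \<in> I \<and> supp g \<subseteq> S" and C: "C \<ge> 0"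
    and GC': "\<forall>v M. v \<in> I \<longrightarrow> supp v \<subseteq> S \<longrightarrow> (\<forall>\<alpha>. cmod (coef v \<alpha>) \<le> M) \<longrightarrow>
       (\<exists>c. v = (\<Sum>g\<in>G. Cst (c g) * g) \<and> (\<forall>g\<in>G. cmod (c g) \<le> C * M))"
    by (elim exE conjE) (rule that)
  have GC: "\<And>v M. v \<in> I \<Longrightarrow> supp v \<subseteq> S \<Longrightarrow> (\<And>\<alpha>. cmod (coef v \<alpha>) \<le> M) \<Longrightarrow>
       \<exists>c. v = (\<Sum>g\<in>G. Cst (c g) * g) \<and> (\<forall>g\<in>G. cmod (c g) \<le> C * M)"
    using GC' by simp
  show ?case
  proof (cases "\<forall>v\<in>I. supp v \<subseteq> insert \<alpha> S \<longrightarrow> coef v \<alpha> = 0")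
    case True
    have sub: "supp v \<subseteq> S" if "v \<in> I" "supp v \<subseteq> insert \<alpha> S" for v
      using True that by (auto simp: in_keys_iff)
    show ?thesis
    proof (rule exI[of _ G], rule exI[of _ C], intro conjI allI impI)
      show "\<forall>g\<in>G. g \<in> I \<and> supp g \<subseteq> insert \<alpha> S" using G(2) by blast
      fix v M assume "v \<in> I" "supp v \<subseteq> insert \<alpha> S" "\<forall>\<alpha>. cmod (coef v \<alpha>) \<le> M"
      then show "\<exists>c. v = (\<Sum>g\<in>G. Cst (c g) * g) \<and> (\<forall>g\<in>G. cmod (c g) \<le> C * M)"
        by (intro GC sub) auto
    qed (use G C in auto)
  next
    case False
    then obtain g0 where g0: "g0 \<in> I" "supp g0 \<subseteq> insert \<alpha> S" "coef g0 \<alpha> \<noteq> 0" by blast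
    define g where "g = Cst (1 / coef g0 \<alpha>) * g0"
    have g: "g \<in> I" "supp g \<subseteq> insert \<alpha> S" "coef g \<alpha> = 1"
      using g0 ideal_mult[OF I g0(1)] by (auto simp: g_def in_keys_iff)
    have "\<alpha> \<in> supp g" using g(3) by (simp add: in_keys_iff)
    \<comment> \<open>\<open>g\<close> involves \<alpha> while \<open>G\<close> lives on
      \<open>S\<close>, so the update \<open>c(g := t)\<close> below leaves the coordinates on
      \<open>G\<close> intact.\<close>
    then have "g \<notin> G" using G(2) insert.hyps(2) by blast
    define L where "L = (\<Sum>\<beta>\<in>supp g. cmod (coef g \<beta>))"
    have L: "0 \<le> L" "cmod (coef g \<beta>) \<le> L" for \<beta>
    proof -
      show "0 \<le> L" by (simp add: L_def sum_nonneg)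
      then show "cmod (coef g \<beta>) \<le> L"
        by (cases "\<beta> \<in> supp g") (auto simp: L_def in_keys_iff intro!: member_le_sum[of \<beta> _ "\<lambda>\<beta>. cmod (coef g \<beta>)"])
    qed
    show ?thesis
    \<comment> \<open>The coordinate of \<open>g\<close> is at most \<open>M\<close>. Its removal
      leaves coefficients of size at most \<open>M * (1 + L)\<close>, to which the old constant
      \<open>C\<close> applies.\<close>
    proof (rule exI[of _ "insert g G"], rule exI[of _ "1 + C * (1 + L)"], intro conjI allI impI)
      show "\<forall>g\<in>insert g G. g \<in> I \<and> supp g \<subseteq> insert \<alpha> S" using G(2) g by blast
      show "0 \<le> 1 + C * (1 + L)" using C L by simp
      fix v M assume v: "v \<in> I" "supp v \<subseteq> insert \<alpha> S" "\<forall>\<alpha>. cmod (coef v \<alpha>) \<le> M"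
      define t where "t = coef v \<alpha>"
      have t: "cmod t \<le> M" using v(3) by (simp add: t_def)
      then have M: "0 \<le> M" using norm_ge_zero[of t] by linarith
      have "v - Cst t * g \<in> I" by (rule ideal_diff[OF I v(1) ideal_mult[OF I g(1)]])
      moreover have "supp (v - Cst t * g) \<subseteq> S"
      proof
        fix \<beta> assume \<beta>: "\<beta> \<in> supp (v - Cst t * g)"
        then have "\<beta> \<in> supp v \<or> \<beta> \<in> supp g" by (auto simp: in_keys_iff lookup_minus)
        then have "\<beta> \<in> insert \<alpha> S" using v(2) g(2) by blast
        moreover have "\<beta> \<noteq> \<alpha>" using \<beta> g(3) by (auto simp: in_keys_iff lookup_minus t_def)
        ultimately show "\<beta> \<in> S" by blast
      qed
      moreover have "cmod (coef (v - Cst t * g) \<beta>) \<le> M * (1 + L)" for \<beta>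
      proof -
        have "cmod (coef (v - Cst t * g) \<beta>) \<le> cmod (coef v \<beta>) + cmod t * cmod (coef g \<beta>)"
          using norm_triangle_ineq4[of "coef v \<beta>" "t * coef g \<beta>"] by (simp add: lookup_minus norm_mult)
        also have "\<dots> \<le> M + M * L"
          by (intro add_mono mult_mono) (use v(3) t L M in auto)
        finally show ?thesis by (simp add: algebra_simps)
      qed
      ultimately have "\<exists>c. v - Cst t * g = (\<Sum>g\<in>G. Cst (c g) * g) \<and> (\<forall>g\<in>G. cmod (c g) \<le> C * (M * (1 + L)))"
        by (rule GC)
      then obtain c where c: "v - Cst t * g = (\<Sum>g\<in>G. Cst (c g) * g)"
        "\<forall>g\<in>G. cmod (c g) \<le> C * (M * (1 + L))"
        by blast
      define d where "d = c(g := t)"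
      have "v = Cst t * g + (v - Cst t * g)" by simp
      also have "\<dots> = Cst (d g) * g + (\<Sum>g\<in>G. Cst (d g) * g)"
        unfolding c(1) using \<open>g \<notin> G\<close>
        by (intro arg_cong2[of _ _ _ _ "(+)"] sum.cong) (auto simp: d_def)
      also have "\<dots> = (\<Sum>g\<in>insert g G. Cst (d g) * g)"
        using \<open>g \<notin> G\<close> G(1) by simp
      finally have "v = (\<Sum>g\<in>insert g G. Cst (d g) * g)" .
      moreover have "cmod (d f) \<le> (1 + C * (1 + L)) * M" if "f \<in> insert g G" for f
      proof (cases "f = g")
        case True
        have "0 \<le> C * (1 + L) * M" using C L M by simp
        then show ?thesis using True t by (simp add: d_def algebra_simps)
      next
        case False
        then have "cmod (d f) \<le> C * (M * (1 + L))" using that c(2) by (simp add: d_def)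
        then show ?thesis using M by (simp add: algebra_simps)
      qed
      ultimately show "\<exists>c. v = (\<Sum>g\<in>insert g G. Cst (c g) * g) \<and> (\<forall>f\<in>insert g G. cmod (c f) \<le> (1 + C * (1 + L)) * M)"
        by blast
    qed (use G in auto)
  qed
qed

section \<open>Small multipliers\<close>

definition avg :: "'n \<Rightarrow> complex \<Rightarrow> nat \<Rightarrow> 'n mpoly" where
  "avg a r n = (\<Sum>j<n. Cst (1 / (of_nat n * r ^ j)) * Var a ^ j)"

text \<open>The coefficients of the mean, taken at z_a = r, sum to 1, and z_a - r divides z_a^j -
  r^j for every j.\<close>

lemma linear_dvd_avg:
  assumes r: "r \<noteq> 0" and n: "n > 0"
  shows "(Var a - Cst r) dvd (1 - avg a r n)"
proof -
  have "(1 :: 'a mpoly) = (\<Sum>j<n. Cst (1 / of_nat n))"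
    using n by (simp only: Cst_sum[symmetric]) simp
  then have "1 - avg a r n = (\<Sum>j<n. Cst (1 / of_nat n) - Cst (1 / (of_nat n * r ^ j)) * Var a ^ j)"
    unfolding avg_def by (simp add: sum_subtractf)
  moreover have "(Var a - Cst r) dvd (Cst (1 / of_nat n) - Cst (1 / (of_nat n * r ^ j)) * Var a ^ j)" for j
  proof -
    have "Cst (1 / of_nat n) = Cst (1 / (of_nat n * r ^ j)) * Cst r ^ j"
      using r by (simp flip: Cst_power Cst_mult)
    then have "Cst (1 / of_nat n) - Cst (1 / (of_nat n * r ^ j)) * Var a ^ j
        = - Cst (1 / (of_nat n * r ^ j)) * (Var a ^ j - Cst r ^ j)"
      by (simp add: algebra_simps)
    moreover have "(Var a - Cst r) dvd (Var a ^ j - Cst r ^ j)"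
      unfolding power_diff_sumr2 by (rule dvd_triv_left)
    ultimately show ?thesis by (simp only: dvd_mult)
  qed
  ultimately show ?thesis by (simp only: dvd_sum)
qed

lemma cmod_avg_coeff_le:
  assumes r: "1 \<le> cmod r"
  shows "cmod (1 / (of_nat n * r ^ j)) \<le> 1 / real n"
proof -
  have "1 \<le> cmod r ^ j" using r by (rule one_le_power)
  then have "1 / cmod r ^ j \<le> 1" by simp
  then have "1 / real n * (1 / cmod r ^ j) \<le> 1 / real n * 1"
    by (intro mult_left_mono) auto
  then show ?thesis by (simp add: norm_divide norm_mult norm_power)
qed

lemma h2_norm_avg_mult_le:
  assumes r: "1 \<le> cmod r"
  shows "h2_norm (avg a r n * p) \<le> h2_norm p"
proof -
  have "h2_norm (avg a r n * p) \<le> (\<Sum>j<n. h2_norm (Cst (1 / (of_nat n * r ^ j)) * (Var a ^ j * p)))"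
    unfolding avg_def sum_distrib_right mult.assoc by (rule h2_norm_sum_le)
  also have "\<dots> \<le> (\<Sum>j<n. 1 / real n * h2_norm p)"
    unfolding h2_norm_Cst_mult
    by (intro sum_mono mult_mono cmod_avg_coeff_le r h2_norm_Var_power_mult_le) auto
  also have "\<dots> \<le> h2_norm p" by simp
  finally show ?thesis .
qed

text \<open>The shifted monomials are orthogonal, so the mean of \<open>n\<close> of them has norm at most \<open>1/\<surd>n\<close>.\<close>

lemma h2_norm_avg_monom_of_le:
  fixes \<alpha> :: "'n::finite \<Rightarrow>\<^sub>0 nat"
  assumes r: "1 \<le> cmod r"
  shows "h2_norm (avg a r n * monom_of \<alpha>) \<le> 1 / sqrt n"
proof -
  let ?f = "\<lambda>j. Poly_Mapping.single a j + \<alpha>"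
  let ?p = "avg a r n * monom_of \<alpha>"
  have inj: "i = j" if "Poly_Mapping.single a i = Poly_Mapping.single a j" for i j :: nat
    using that by (metis lookup_single_eq)
  have "?p = (\<Sum>j<n. Cst (1 / (of_nat n * r ^ j)) * monom_of (?f j))"
    by (simp add: avg_def sum_distrib_right Var_power monom_of_add mult.assoc)
  then have coef_p: "coef ?p \<beta> = (\<Sum>j<n. 1 / (of_nat n * r ^ j) * (if \<beta> = ?f j then 1 else 0))" for \<beta>
    by (simp only: lookup_sum coef_Cst_mult coef_monom_of)
  have supp: "supp ?p \<subseteq> ?f ` {..<n}"
  proof
    fix \<beta> assume "\<beta> \<in> supp ?p"
    then have "(\<Sum>j<n. 1 / (of_nat n * r ^ j) * (if \<beta> = ?f j then 1 else 0)) \<noteq> 0"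
      unfolding in_keys_iff coef_p .
    then obtain j where "j \<in> {..<n}" "1 / (of_nat n * r ^ j) * (if \<beta> = ?f j then 1 else 0) \<noteq> 0"
      by (rule sum.not_neutral_contains_not_neutral)
    then have "j \<in> {..<n}" "\<beta> = ?f j" by (auto split: if_splits)
    then show "\<beta> \<in> ?f ` {..<n}" by blast
  qed
  have le: "cmod (coef ?p \<beta>) * sqrt (h2_weight \<beta>) \<le> 1 / real n" if \<beta>: "\<beta> \<in> ?f ` {..<n}" for \<beta>
  proof -
    obtain i where i: "i < n" "\<beta> = ?f i" using \<beta> by blast
    have "coef ?p \<beta> = (\<Sum>j<n. if j = i then 1 / (of_nat n * r ^ i) else 0)"
      unfolding coef_p i(2) by (rule sum.cong) (auto dest: inj)
    then have "cmod (coef ?p \<beta>) \<le> 1 / real n"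
      using i(1) cmod_avg_coeff_le[OF r, of n i] by simp
    then have "cmod (coef ?p \<beta>) * sqrt (h2_weight \<beta>) \<le> 1 / real n * 1"
      by (rule mult_mono) (simp_all add: h2_weight_le_1 h2_weight_pos less_imp_le)
    then show ?thesis by simp
  qed
  have "h2_norm ?p = L2_set (\<lambda>\<beta>. cmod (coef ?p \<beta>) * sqrt (h2_weight \<beta>)) (?f ` {..<n})"
    by (rule h2_norm_superset[OF _ supp]) simp
  also have "\<dots> \<le> L2_set (\<lambda>_. 1 / real n) (?f ` {..<n})"
    by (rule L2_set_mono) (auto simp: h2_weight_pos less_imp_le intro: le)
  also have "\<dots> = sqrt (card (?f ` {..<n})) * (1 / real n)"
    by (simp add: L2_set_constant)
  also have "\<dots> \<le> sqrt n * (1 / real n)"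
    using card_image_le[of "{..<n}" ?f] by (intro mult_right_mono) auto
  also have "\<dots> = 1 / sqrt n"
    by (cases "n = 0") (simp_all add: field_simps)
  finally show ?thesis .
qed

lemma h2_norm_avg_mult_tendsto_0:
  fixes q :: "'n::finite mpoly"
  assumes r: "1 \<le> cmod r"
  shows "(\<lambda>n. h2_norm (avg a r n * q)) \<longlonglongrightarrow> 0"
proof (rule tendsto_sandwich[OF always_eventually always_eventually])
  let ?M = "\<Sum>\<alpha>\<in>supp q. cmod (coef q \<alpha>)"
  show "\<forall>n. 0 \<le> h2_norm (avg a r n * q)" by simp
  show "\<forall>n. h2_norm (avg a r n * q) \<le> ?M * (1 / sqrt n)"
  proof
    fix n
    have "avg a r n * q = (\<Sum>\<alpha>\<in>supp q. Cst (coef q \<alpha>) * (avg a r n * monom_of \<alpha>))"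
      by (subst (1) mpoly_sum_monom_of[of q]) (simp add: sum_distrib_left mult.left_commute)
    then have "h2_norm (avg a r n * q) \<le> (\<Sum>\<alpha>\<in>supp q. cmod (coef q \<alpha>) * h2_norm (avg a r n * monom_of \<alpha>))"
      using h2_norm_sum_le by (metis (no_types, lifting) h2_norm_Cst_mult sum.cong)
    also have "\<dots> \<le> (\<Sum>\<alpha>\<in>supp q. cmod (coef q \<alpha>) * (1 / sqrt n))"
      by (intro sum_mono mult_left_mono h2_norm_avg_monom_of_le r) simp
    finally show "h2_norm (avg a r n * q) \<le> ?M * (1 / sqrt n)"
      by (simp only: sum_distrib_right)
  qed
  have "(\<lambda>n. sqrt (1 / real n)) \<longlonglongrightarrow> sqrt 0"
    by (intro tendsto_real_sqrt lim_1_over_n)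
  then have "(\<lambda>n. 1 / sqrt (real n)) \<longlonglongrightarrow> 0" by (simp add: real_sqrt_divide)
  then show "(\<lambda>n. ?M * (1 / sqrt (real n))) \<longlonglongrightarrow> 0"
    by (rule tendsto_mult_right_zero)
qed simp

text \<open>With x = 1 - \<open>avg a r n\<close>, the multiplier is 1 - x^k = (1 + x + ... +
  x^(k-1)) (1 - x). The factor 1 - x tends to 0 on each \<open>q\<close>, the powers of x stay
  bounded uniformly in n, and z_a - r divides x.\<close>

lemma small_multiplier:
  fixes Q :: "'n::finite mpoly set"
  assumes r: "1 \<le> cmod r" and Q: "finite Q" and \<epsilon>: "0 < \<epsilon>"
  shows "\<exists>A s. A = 1 - (Var a - Cst r) ^ k * s \<and> (\<forall>q\<in>Q. h2_norm (A * q) \<le> \<epsilon>)"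
proof -
  define A where "A n = 1 - (1 - avg a r n) ^ k" for n
  define C where "C = (\<Sum>i<k. 2 ^ i :: real)"
  have pow: "h2_norm ((1 - avg a r n) ^ i * p) \<le> 2 ^ i * h2_norm p" for i n p
  proof (induction i)
    case (Suc i)
    let ?p = "(1 - avg a r n) ^ i * p"
    have "h2_norm ((1 - avg a r n) ^ Suc i * p) = h2_norm (?p - avg a r n * ?p)"
      by (simp add: algebra_simps)
    also have "\<dots> \<le> 2 * h2_norm ?p"
      using h2_norm_triangle_diff[of ?p "avg a r n * ?p"] h2_norm_avg_mult_le[OF r, of a n ?p] by linarith
    finally show ?case using Suc by simp
  qed simp
  have A_le: "h2_norm (A n * q) \<le> C * h2_norm (avg a r n * q)" for n q
  proof -
    have "A n * q = (\<Sum>i<k. (1 - avg a r n) ^ i * (avg a r n * q))"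
      unfolding A_def one_diff_power_eq by (simp add: sum_distrib_right sum_distrib_left mult_ac)
    then have "h2_norm (A n * q) \<le> (\<Sum>i<k. h2_norm ((1 - avg a r n) ^ i * (avg a r n * q)))"
      using h2_norm_sum_le by metis
    also have "\<dots> \<le> (\<Sum>i<k. 2 ^ i * h2_norm (avg a r n * q))"
      by (intro sum_mono pow)
    finally show ?thesis by (simp only: C_def sum_distrib_right)
  qed
  have "eventually (\<lambda>n. h2_norm (A n * q) < \<epsilon>) sequentially" for q
  proof -
    have "(\<lambda>n. C * h2_norm (avg a r n * q)) \<longlonglongrightarrow> 0"
      by (rule tendsto_mult_right_zero[OF h2_norm_avg_mult_tendsto_0[OF r]])
    then have "eventually (\<lambda>n. C * h2_norm (avg a r n * q) < \<epsilon>) sequentially"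
      using \<epsilon> by (rule order_tendstoD)
    then show ?thesis
      by (rule eventually_mono) (meson A_le le_less_trans)
  qed
  then have "eventually (\<lambda>n. \<forall>q\<in>Q. h2_norm (A n * q) < \<epsilon>) sequentially"
    using Q by (simp add: eventually_ball_finite)
  \<comment> \<open>The empty mean is 0, so divisibility is available only for positive
    \<open>n\<close>.\<close>
  then have "eventually (\<lambda>n. n > 0 \<and> (\<forall>q\<in>Q. h2_norm (A n * q) < \<epsilon>)) sequentially"
    using eventually_gt_at_top[of 0] by eventually_elim simp
  then obtain n where n: "n > 0" "\<And>q. q \<in> Q \<Longrightarrow> h2_norm (A n * q) < \<epsilon>"
    by (auto simp: eventually_sequentially)
  have "r \<noteq> 0" using r by auto
  then have "(Var a - Cst r) ^ k dvd (1 - avg a r n) ^ k"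
    by (intro dvd_power_same linear_dvd_avg n(1))
  then obtain s where "(1 - avg a r n) ^ k = (Var a - Cst r) ^ k * s" by (elim dvdE)
  then show ?thesis
    using n(2) by (intro exI[of _ "A n"] exI[of _ s]) (auto simp: A_def less_imp_le)
qed

section \<open>Ideals with one zero\<close>

text \<open>Passing from \<open>v\<close> to \<open>A * v\<close> changes it by a multiple of
  \<open>f\<close>, which joins the term of \<open>f\<close>. That term equals
  \<open>h - A * v\<close>, so it is bounded without any control of \<open>q\<close> or
  \<open>s\<close>.\<close>

lemma bdiv_combine:
  fixes h :: "'n::finite mpoly" and B :: real
  assumes G: "finite G" and h: "h = v + f * q" and v: "v = (\<Sum>g\<in>G. Cst (c g) * g)"
    and A: "A = 1 - f * s" and B: "0 \<le> B" "\<And>g. g \<in> G \<Longrightarrow> h2_norm (A * (Cst (c g) * g)) \<le> B"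
  shows "bdiv (insert f G) (h2_norm h + card G * B + B) h"
proof -
  have Av: "A * v = (\<Sum>g\<in>G. A * (Cst (c g) * g))"
    by (simp add: v sum_distrib_left)
  have "bdiv G B (A * v)"
    unfolding bdiv_def Av using B(2) by (intro exI[of _ "\<lambda>g. A * Cst (c g)"]) (simp add: mult.assoc)
  moreover have eq: "(q + s * v) * f = h - A * v"
    by (simp add: h A algebra_simps)
  have "h2_norm (A * v) \<le> (\<Sum>g\<in>G. B)"
    unfolding Av by (rule order_trans[OF h2_norm_sum_le]) (rule sum_mono, rule B(2))
  then have "h2_norm ((q + s * v) * f) \<le> h2_norm h + card G * B"
    unfolding eq using h2_norm_triangle_diff[of h "A * v"] by simp
  then have "bdiv {f} (h2_norm h + card G * B) ((q + s * v) * f)"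
    by (rule bdiv_single)
  ultimately have "bdiv ({f} \<union> G) (h2_norm h + card G * B + B) ((q + s * v) * f + A * v)"
    using G B(1) by (intro bdiv_add) auto
  then show ?thesis by (simp add: eq)
qed

lemma ideal_power_mono:
  assumes I: "is_ideal I" and "x ^ m \<in> I" "m \<le> n"
  shows "x ^ n \<in> I"
proof -
  have "x ^ n = x ^ (n - m) * x ^ m" using assms(3) by (simp flip: power_add)
  then show ?thesis using ideal_mult[OF I assms(2)] by simp
qed

text \<open>\<open>G\<close> is fixed before \<open>h\<close> is given. For |r| < 1 the coordinates
  of the remainder are bounded by the norm of \<open>h\<close>; for |r| >= 1 a multiplier chosen for
  the given \<open>h\<close> shrinks the terms instead.\<close>

lemma bdiv_cylinder:
  fixes I :: "'n::finite mpoly set" and a :: 'n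
  assumes I: "is_ideal I" and f: "(Var a - Cst r) ^ k \<in> I"
  shows "\<exists>G C. finite G \<and> G \<subseteq> I \<and> C \<ge> 0 \<and>
    (\<forall>h\<in>I. supp h \<subseteq> cyl a k \<longrightarrow> bdiv (insert ((Var a - Cst r) ^ k) G) (C * h2_norm h) h)"
proof -
  define f where "f = (Var a - Cst r) ^ k"
  define S where "S = {\<alpha> :: 'n \<Rightarrow>\<^sub>0 nat. \<forall>j. coef \<alpha> j < k}"
  have S: "cyl a k \<inter> {\<alpha>. coef \<alpha> a < k} \<subseteq> S" by (auto simp: S_def cyl_def)
  have finS: "finite S" unfolding S_def by (rule finite_multi_index_less)
  \<comment> \<open>For |r| < 1 the radius lies strictly between |r| and 1, as the comparison with
    the H^2 norm demands. For |r| >= 1 any radius beyond |r| makes the division available.\<close>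
  define \<rho> where "\<rho> = (if cmod r < 1 then (cmod r + 1) / 2 else cmod r + 1)"
  have \<rho>: "cmod r < \<rho>" "0 < \<rho>" "cmod r < 1 \<Longrightarrow> \<rho> < 1"
    using norm_ge_zero[of r] by (auto simp: \<rho>_def add_nonneg_pos)
  obtain C1 where C1: "C1 \<ge> 0" "\<And>p. supp p \<subseteq> cyl a k \<Longrightarrow> \<exists>v q. p = v + f * q \<and>
    supp v \<subseteq> cyl a k \<inter> {\<alpha>. coef \<alpha> a < k} \<and> wnorm a \<rho> v \<le> C1 * wnorm a \<rho> p"
    using division_linear_power[OF \<rho>(1), of a k k] unfolding f_def by blast
  obtain G C2 where fin_G: "finite G" and G': "\<forall>g\<in>G. g \<in> I \<and> supp g \<subseteq> S" and C2: "C2 \<ge> 0"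
    and coords': "\<forall>v M. v \<in> I \<longrightarrow> supp v \<subseteq> S \<longrightarrow> (\<forall>\<alpha>. cmod (coef v \<alpha>) \<le> M) \<longrightarrow>
       (\<exists>c. v = (\<Sum>g\<in>G. Cst (c g) * g) \<and> (\<forall>g\<in>G. cmod (c g) \<le> C2 * M))"
    using bounded_coordinates[OF I finS] by (elim exE conjE) (rule that)
  have G: "finite G" "\<And>g. g \<in> G \<Longrightarrow> g \<in> I" using fin_G G' by blast+
  have coords: "\<And>v M. v \<in> I \<Longrightarrow> supp v \<subseteq> S \<Longrightarrow> (\<And>\<alpha>. cmod (coef v \<alpha>) \<le> M) \<Longrightarrow>
       \<exists>c. v = (\<Sum>g\<in>G. Cst (c g) * g) \<and> (\<forall>g\<in>G. cmod (c g) \<le> C2 * M)"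
    using coords' by simp
  have division: "\<exists>v q. h = v + f * q \<and> v \<in> I \<and> supp v \<subseteq> S \<and> wnorm a \<rho> v \<le> C1 * wnorm a \<rho> h"
    if h: "h \<in> I" "supp h \<subseteq> cyl a k" for h
  proof -
    obtain v q where vq: "h = v + f * q" "supp v \<subseteq> cyl a k \<inter> {\<alpha>. coef \<alpha> a < k}" "wnorm a \<rho> v \<le> C1 * wnorm a \<rho> h"
      using C1(2)[OF h(2)] by blast
    have "v = h - q * f" using vq(1) by simp
    moreover have "h - q * f \<in> I"
      unfolding f_def by (rule ideal_diff[OF I h(1) ideal_mult[OF I f]])
    ultimately have "v \<in> I" by simp
    moreover have "supp v \<subseteq> S" using vq(2) S by blast
    ultimately show ?thesis using vq by blast
  qed
  have "\<exists>C\<ge>0. \<forall>h\<in>I. supp h \<subseteq> cyl a k \<longrightarrow> bdiv (insert f G) (C * h2_norm h) h"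
  proof (cases "cmod r < 1")
    case True
    then obtain C3 where C3: "C3 \<ge> 0" "\<And>p. supp p \<subseteq> cyl a k \<Longrightarrow> wnorm a \<rho> p \<le> C3 * h2_norm p"
      using wnorm_le_h2_norm[OF \<rho>(2) \<rho>(3)[OF True], of a k] by blast
    define L where "L = (\<Sum>g\<in>G. h2_norm g)"
    \<comment> \<open>The chain of estimates: \<open>C3\<close> passes from H^2 to the weighted
      norm, \<open>C1\<close> to the remainder, the power of \<rho> to its coefficients,
      \<open>C2\<close> to coordinates, \<open>L\<close> to the terms.\<close>
    define D where "D = C2 * (C1 * C3 / \<rho> ^ k) * L"
    have L: "0 \<le> L" "\<And>g. g \<in> G \<Longrightarrow> h2_norm g \<le> L"
      unfolding L_def using G(1) by (auto intro: sum_nonneg member_le_sum)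
    have D: "0 \<le> D" unfolding D_def using C1(1) C2 C3(1) \<rho>(2) L(1) by simp
    show ?thesis
    proof (rule exI[of _ "1 + card G * D + D"], intro conjI ballI impI)
      show "0 \<le> 1 + card G * D + D" using D by simp
      fix h assume h: "h \<in> I" "supp h \<subseteq> cyl a k"
      obtain v q where vq: "h = v + f * q" "v \<in> I" "supp v \<subseteq> S" "wnorm a \<rho> v \<le> C1 * wnorm a \<rho> h"
        using division[OF h] by blast
      have coef_v: "cmod (coef v \<alpha>) \<le> C1 * C3 / \<rho> ^ k * h2_norm h" for \<alpha>
      proof (cases "\<alpha> \<in> supp v")
        case \<alpha>: True
        then have "coef \<alpha> a \<le> k" using vq(3) by (auto simp: S_def less_imp_le)
        then have "\<rho> ^ k \<le> \<rho> ^ coef \<alpha> a"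
          using \<rho>(2) \<rho>(3)[OF True] by (intro power_decreasing) auto
        then have "cmod (coef v \<alpha>) * \<rho> ^ k \<le> cmod (coef v \<alpha>) * \<rho> ^ coef \<alpha> a"
          by (rule mult_left_mono) simp
        also have "\<dots> \<le> wnorm a \<rho> v" using \<rho>(2) by (intro coef_le_wnorm) simp
        also have "\<dots> \<le> C1 * (C3 * h2_norm h)"
          by (rule order_trans[OF vq(4) mult_left_mono[OF C3(2)[OF h(2)] C1(1)]])
        finally show ?thesis using \<rho>(2) by (simp add: pos_le_divide_eq mult.assoc)
      next
        case False
        then show ?thesis using C1(1) C3(1) \<rho>(2) by (simp add: in_keys_iff)
      qed
      obtain c where c: "v = (\<Sum>g\<in>G. Cst (c g) * g)" "\<forall>g\<in>G. cmod (c g) \<le> C2 * (C1 * C3 / \<rho> ^ k * h2_norm h)"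
        using coords[OF vq(2,3) coef_v] by (elim exE conjE) (rule that)
      have "bdiv (insert f G) (h2_norm h + card G * (D * h2_norm h) + D * h2_norm h) h"
      \<comment> \<open>The remainder is already bounded, so it is kept as it is.\<close>
      proof (rule bdiv_combine[where A = 1 and s = 0, OF G(1) vq(1) c(1)])
        show "0 \<le> D * h2_norm h" using D by simp
        fix g assume g: "g \<in> G"
        have "cmod (c g) * h2_norm g \<le> C2 * (C1 * C3 / \<rho> ^ k * h2_norm h) * L"
          using c(2) g L C1(1) C2 C3(1) \<rho>(2) by (intro mult_mono) auto
        also have "\<dots> = D * h2_norm h" by (simp add: D_def mult_ac)
        finally show "h2_norm (1 * (Cst (c g) * g)) \<le> D * h2_norm h"
          by (simp add: h2_norm_Cst_mult)
      qed simp
      then show "bdiv (insert f G) ((1 + card G * D + D) * h2_norm h) h"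
        by (simp add: distrib_right mult.assoc)
    qed
  next
    case False
    show ?thesis
    proof (rule exI[of _ "1 + real (card G) + 1"], intro conjI ballI impI)
      fix h assume h: "h \<in> I" "supp h \<subseteq> cyl a k"
      show "bdiv (insert f G) ((1 + real (card G) + 1) * h2_norm h) h"
      \<comment> \<open>The norm of \<open>h\<close> serves as the tolerance of
        \<open>small_multiplier\<close>, which has to be positive.\<close>
      proof (cases "h = 0")
        case True
        then show ?thesis unfolding bdiv_def by (intro exI[of _ "\<lambda>_. 0"]) simp
      next
        case h0: False
        obtain v q where vq: "h = v + f * q" "v \<in> I" "supp v \<subseteq> S"
          using division[OF h] by blast
        have "cmod (coef v \<alpha>) \<le> (\<Sum>\<beta>\<in>supp v. cmod (coef v \<beta>))" for \<alpha>
          by (cases "\<alpha> \<in> supp v") (auto simp: in_keys_iff sum_nonneg intro!: member_le_sum[of \<alpha> _ "\<lambda>\<beta>. cmod (coef v \<beta>)"])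
        from coords[OF vq(2,3) this] obtain c where c: "v = (\<Sum>g\<in>G. Cst (c g) * g)"
          by (elim exE conjE) (rule that)
        have "h2_norm h > 0" using h0 h2_norm_eq_0_iff[of h] h2_norm_nonneg[of h] by linarith
        moreover have "1 \<le> cmod r" using False by simp
        moreover have "finite ((\<lambda>g. Cst (c g) * g) ` G)" using G(1) by simp
        ultimately have "\<exists>A s. A = 1 - f * s \<and> (\<forall>q\<in>(\<lambda>g. Cst (c g) * g) ` G. h2_norm (A * q) \<le> h2_norm h)"
          unfolding f_def by (intro small_multiplier)
        then obtain A s where A: "A = 1 - f * s" "\<forall>q\<in>(\<lambda>g. Cst (c g) * g) ` G. h2_norm (A * q) \<le> h2_norm h"
          by blast
        have "bdiv (insert f G) (h2_norm h + card G * h2_norm h + h2_norm h) h"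
          by (rule bdiv_combine[OF G(1) vq(1) c A(1)]) (use A(2) in auto)
        then show ?thesis by (simp add: distrib_right)
      qed
    qed simp
  qed
  then obtain C where "C \<ge> 0" "\<forall>h\<in>I. supp h \<subseteq> cyl a k \<longrightarrow> bdiv (insert f G) (C * h2_norm h) h"
    by blast
  moreover have "G \<subseteq> I" using G(2) by blast
  ultimately show ?thesis
    using G(1) unfolding f_def by (intro exI[of _ G] exI[of _ C] conjI)
qed

text \<open>The pieces split off are multiples of members of \<open>I\<close>, so the cylinder part
  stays in \<open>I\<close>; being a restriction, it has norm at most that of
  \<open>h\<close>.\<close>

lemma stable_division_axis:
  fixes I :: "'n::finite mpoly set" and a :: 'n
  assumes I: "is_ideal I" and X: "\<And>j. j \<noteq> a \<Longrightarrow> Var j ^ k \<in> I" and f: "(Var a - Cst r) ^ k \<in> I"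
  shows "stable_division_property h2_norm I"
proof -
  obtain G C where G: "finite G" "G \<subseteq> I" "C \<ge> 0"
    "\<And>h. h \<in> I \<Longrightarrow> supp h \<subseteq> cyl a k \<Longrightarrow> bdiv (insert ((Var a - Cst r) ^ k) G) (C * h2_norm h) h"
    using bdiv_cylinder[OF I f] by blast
  let ?J = "UNIV - {a}"
  let ?F = "(\<Union>j\<in>?J. {Var j ^ k}) \<union> insert ((Var a - Cst r) ^ k) G"
  show ?thesis
  proof (rule stable_divisionI[OF I])
    show "finite ?F" using G(1) by simp
    show "?F \<subseteq> I" using G(2) X f by auto
    fix h assume h: "h \<in> I"
    obtain S where S: "h = (\<Sum>j\<in>?J. restr (S j) h) + restr (cyl a k) h" "\<And>j \<alpha>. \<alpha> \<in> S j \<Longrightarrow> k \<le> coef \<alpha> j"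
      using cyl_decomposition[of h a k] by blast
    have "\<exists>q. restr (S j) h = q * Var j ^ k" for j
      using supp_restr[of "S j" h] S(2) by (intro Var_power_dvd) blast
    then obtain q where q: "\<And>j. restr (S j) h = q j * Var j ^ k" by metis
    have bd: "bdiv {Var j ^ k} (h2_norm h) (restr (S j) h)" for j
    proof -
      have "h2_norm (q j * Var j ^ k) \<le> h2_norm h"
        using h2_norm_restr_le[of "S j" h] by (simp only: q)
      then show ?thesis unfolding q by (rule bdiv_single)
    qed
    have sum_bd: "bdiv (\<Union>j\<in>?J. {Var j ^ k}) (\<Sum>j\<in>?J. h2_norm h) (\<Sum>j\<in>?J. restr (S j) h)"
      by (rule bdiv_sum) (simp_all add: bd)
    have "(\<Sum>j\<in>?J. restr (S j) h) \<in> I"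
      unfolding q by (intro ideal_sum[OF I] ideal_mult[OF I] X) simp
    moreover have "restr (cyl a k) h = h - (\<Sum>j\<in>?J. restr (S j) h)"
      using S(1) by (metis add_diff_cancel_left')
    ultimately have "restr (cyl a k) h \<in> I" using ideal_diff[OF I h] by simp
    then have "bdiv (insert ((Var a - Cst r) ^ k) G) (C * h2_norm (restr (cyl a k) h)) (restr (cyl a k) h)"
      by (rule G(4)) (rule supp_restr)
    then have "bdiv (insert ((Var a - Cst r) ^ k) G) (C * h2_norm h) (restr (cyl a k) h)"
      by (rule bdiv_mono) (intro mult_left_mono h2_norm_restr_le G(3))
    then have "bdiv ?F ((\<Sum>j\<in>?J. h2_norm h) + C * h2_norm h) ((\<Sum>j\<in>?J. restr (S j) h) + restr (cyl a k) h)"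
      using G sum_bd by (intro bdiv_add) auto
    then show "bdiv ?F ((card ?J + C) * h2_norm h) h"
      using S(1) by (simp add: distrib_right)
  qed
qed

text \<open>Every binomial term has an exponent of \<open>x\<close> of at least \<open>m\<close> or
  an exponent of \<open>y\<close> above \<open>n\<close>.\<close>

lemma ideal_add_power:
  assumes I: "is_ideal I" and x: "x ^ m \<in> I" and y: "y ^ n \<in> I"
  shows "(x + y) ^ (m + n) \<in> I"
  unfolding binomial_ring
proof (rule ideal_sum[OF I])
  fix i assume i: "i \<in> {..m + n}"
  show "of_nat (m + n choose i) * x ^ i * y ^ (m + n - i) \<in> I"
  proof (cases "m \<le> i")
    case True
    then have "x ^ i \<in> I" using ideal_power_mono[OF I x] by blast
    then have "of_nat (m + n choose i) * y ^ (m + n - i) * x ^ i \<in> I" by (rule ideal_mult[OF I])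
    then show ?thesis by (simp only: mult.assoc mult.commute[of "x ^ i"])
  next
    case False
    then have "y ^ (m + n - i) \<in> I" using ideal_power_mono[OF I y] by simp
    then show ?thesis by (rule ideal_mult[OF I])
  qed
qed

text \<open>The \<open>+ 1\<close> in the exponent serves the empty sum, whose power 0 would be
  1.\<close>

lemma ideal_sum_power:
  assumes I: "is_ideal I" and "finite A" "\<And>i. i \<in> A \<Longrightarrow> x i ^ k \<in> I"
  shows "(\<Sum>i\<in>A. x i) ^ (card A * k + 1) \<in> I"
  using assms(2,3)
proof induction
  case empty
  show ?case using ideal_0[OF I] by simp
next
  case (insert i A)
  have "(x i + (\<Sum>i\<in>A. x i)) ^ (k + (card A * k + 1)) \<in> I"
    by (rule ideal_add_power[OF I]) (use insert in auto)
  then show ?case using insert.hyps by (simp add: algebra_simps)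
qed

text \<open>After the rotation, a coordinate minus its value at the moved point is a combination of
  the z_i - p_i. Each of these is nilpotent modulo \<open>I\<close>, hence so is the combination,
  with the larger exponent \<open>K\<close>.\<close>

lemma stable_division_point:
  fixes I :: "'n::finite mpoly set"
  assumes I: "is_ideal I" and p: "\<And>i. (Var i - Cst (p i)) ^ k \<in> I"
  shows "stable_division_property h2_norm I"
proof -
  \<comment> \<open>Any axis will do; there is one because types are nonempty.\<close>
  fix a :: 'n
  obtain u r where u: "hermitian_unitary u" and r: "\<And>j. (\<Sum>i\<in>UNIV. u j i * p i) = (if j = a then r else 0)"
    using householder[of p a] by blast
  interpret hermitian_unitary u by (rule u)
  define K where "K = card (UNIV :: 'n set) * k + 1"
  have *: "(Var j - Cst (if j = a then r else 0)) ^ K \<in> rot ` I" for j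
  proof -
    have "rot (Var j - Cst (if j = a then r else 0)) = (\<Sum>i\<in>UNIV. Cst (u j i) * Var i) - Cst (\<Sum>i\<in>UNIV. u j i * p i)"
      unfolding r subst_diff subst_Cst subst_Var lin_form_def ..
    also have "\<dots> = (\<Sum>i\<in>UNIV. Cst (u j i) * (Var i - Cst (p i)))"
      by (simp add: Cst_sum Cst_mult right_diff_distrib sum_subtractf)
    finally have eq: "rot (Var j - Cst (if j = a then r else 0)) = (\<Sum>i\<in>UNIV. Cst (u j i) * (Var i - Cst (p i)))" .
    have "rot ((Var j - Cst (if j = a then r else 0)) ^ K) \<in> I"
      unfolding subst_power eq K_def
      by (rule ideal_sum_power[OF I]) (auto simp: power_mult_distrib intro: ideal_mult[OF I] p)
    then have "rot (rot ((Var j - Cst (if j = a then r else 0)) ^ K)) \<in> rot ` I" by (rule imageI)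
    then show ?thesis by simp
  qed
  have "stable_division_property h2_norm (rot ` I)"
  proof (rule stable_division_axis[OF ideal_rot[OF I]])
    show "Var j ^ K \<in> rot ` I" if "j \<noteq> a" for j using *[of j] that by simp
    show "(Var a - Cst r) ^ K \<in> rot ` I" using *[of a] by simp
  qed
  then show ?thesis by (rule stable_division_rot[OF I])
qed

section \<open>Splitting the zeros\<close>

definition comaximal :: "'a::comm_ring_1 \<Rightarrow> 'a \<Rightarrow> bool" where
  "comaximal x y \<longleftrightarrow> (\<exists>s t. s * x + t * y = 1)"

lemma comaximal_sym: "comaximal x y \<Longrightarrow> comaximal y x"
  unfolding comaximal_def by (metis add.commute)

lemma comaximal_1: "comaximal x 1"
  unfolding comaximal_def by (intro exI[of _ 0] exI[of _ 1]) simp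

lemma comaximal_mult:
  assumes "comaximal x y" "comaximal x z"
  shows "comaximal x (y * z)"
proof -
  obtain s t s' t' where st: "s * x + t * y = 1" "s' * x + t' * z = 1"
    using assms unfolding comaximal_def by blast
  have "(s * (s' * x + t' * z) + s' * (t * y)) * x + (t * t') * (y * z) = (s * x + t * y) * (s' * x + t' * z)"
    by (simp add: algebra_simps)
  also have "\<dots> = 1" by (simp add: st)
  finally show ?thesis unfolding comaximal_def by blast
qed

lemma comaximal_power: "comaximal x y \<Longrightarrow> comaximal x (y ^ n)"
  by (induction n) (auto intro: comaximal_mult comaximal_1)

lemma comaximal_prod: "(\<And>i. i \<in> A \<Longrightarrow> comaximal x (f i)) \<Longrightarrow> comaximal x (prod f A)"
  by (induction A rule: infinite_finite_induct) (auto intro: comaximal_mult comaximal_1)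

lemma comaximal_linear:
  assumes "c \<noteq> d"
  shows "comaximal (Var i - Cst c) (Var i - Cst d)"
proof -
  have "Cst (1 / (d - c)) * (Var i - Cst c) + - Cst (1 / (d - c)) * (Var i - Cst d)
      = Cst (1 / (d - c)) * (Cst d - Cst c)"
    by (simp add: algebra_simps)
  also have "\<dots> = 1" using assms by (simp flip: Cst_diff Cst_mult)
  finally show ?thesis unfolding comaximal_def by blast
qed

text \<open>The splitting works on candidate coordinates, not on points: one \<open>R i\<close> is
  divided into {c} and the rest, with comaximal products \<open>u\<close>, \<open>v\<close> and
  \<open>u * v\<close> in \<open>I\<close>. Adjoining \<open>u\<close> or \<open>v\<close> shrinks
  the total number of candidates, until at most one remains per variable.\<close>

lemma stable_division_prod_linear:
  fixes I :: "'n::finite mpoly set"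
  assumes "is_ideal I" "\<And>i. finite (R i)" "\<And>i. (\<Prod>c\<in>R i. (Var i - Cst c) ^ k) \<in> I"
  shows "stable_division_property h2_norm I"
  using assms
proof (induction "\<Sum>i\<in>UNIV. card (R i)" arbitrary: I R rule: less_induct)
  case less
  note I = less.prems(1) and fin = less.prems(2) and R = less.prems(3)
  show ?case
  proof (cases "\<forall>i. card (R i) \<le> 1")
    case True
    have "\<exists>c. (Var i - Cst c) ^ k \<in> I" for i
    \<comment> \<open>An empty product puts 1 into \<open>I\<close>, and then any \<open>c\<close>
      serves.\<close>
    proof (cases "R i = {}")
      case True
      then have "1 \<in> I" using R[of i] by simp
      then show ?thesis using ideal_eq_UNIV[OF I] by blast
    next
      case False
      then have "card (R i) = 1" using True fin[of i] by (metis One_nat_def card_gt_0_iff le_antisym Suc_leI)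
      then obtain c where "R i = {c}" by (rule card_1_singletonE)
      then show ?thesis using R[of i] by auto
    qed
    then obtain p where "\<And>i. (Var i - Cst (p i)) ^ k \<in> I" by metis
    then show ?thesis by (rule stable_division_point[OF I])
  next
    case False
    \<comment> \<open>Two candidates are required for both {c} and its complement in
      \<open>R i\<close> to be smaller than \<open>R i\<close>.\<close>
    then obtain i where i: "2 \<le> card (R i)" by (metis not_less_eq_eq numeral_2_eq_2 One_nat_def)
    then obtain c where c: "c \<in> R i" by (metis all_not_in_conv card.empty not_numeral_le_zero)
    define u where "u = (Var i - Cst c) ^ k"
    define v where "v = (\<Prod>d\<in>R i - {c}. (Var i - Cst d) ^ k)"
    have uv: "u * v \<in> I"
      using R[of i] unfolding u_def v_def by (simp add: prod.remove[OF fin c])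
    have "comaximal u v"
      unfolding u_def v_def
      by (intro comaximal_prod comaximal_power comaximal_sym[OF comaximal_power] comaximal_linear) auto
    then obtain s t where st: "s * u + t * v = 1" unfolding comaximal_def by blast
    let ?I1 = "ideal_adjoin I u" and ?I2 = "ideal_adjoin I v"
    have sub: "I \<subseteq> ?I1" "I \<subseteq> ?I2" by (rule ideal_adjoin_superset)+
    have smaller: "(\<Sum>j\<in>UNIV. card ((R(i := T)) j)) < (\<Sum>j\<in>UNIV. card (R j))" if "card T < card (R i)" for T
      by (rule sum_strict_mono_ex1) (use that in auto)
    have "stable_division_property h2_norm ?I1"
    proof (rule less.hyps)
      show "(\<Sum>j\<in>UNIV. card ((R(i := {c})) j)) < (\<Sum>j\<in>UNIV. card (R j))"
        using i by (intro smaller) simp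
      show "is_ideal ?I1" by (rule ideal_adjoin[OF I])
      show "finite ((R(i := {c})) j)" for j using fin by simp
      show "(\<Prod>d\<in>(R(i := {c})) j. (Var j - Cst d) ^ k) \<in> ?I1" for j
        using R[of j] sub(1) ideal_adjoin_generator[OF I, of u] by (cases "j = i") (auto simp: u_def)
    qed
    moreover have "stable_division_property h2_norm ?I2"
    proof (rule less.hyps)
      show "(\<Sum>j\<in>UNIV. card ((R(i := R i - {c})) j)) < (\<Sum>j\<in>UNIV. card (R j))"
        using c fin by (intro smaller card_Diff1_less)
      show "is_ideal ?I2" by (rule ideal_adjoin[OF I])
      show "finite ((R(i := R i - {c})) j)" for j using fin by simp
      show "(\<Prod>d\<in>(R(i := R i - {c})) j. (Var j - Cst d) ^ k) \<in> ?I2" for j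
        using R[of j] sub(2) ideal_adjoin_generator[OF I, of v] by (cases "j = i") (auto simp: v_def)
    qed
    moreover have "t * v * x \<in> I" if x1: "x \<in> ?I1" for x
    proof -
      obtain y g where x: "x = y + g * u" "y \<in> I" using x1 unfolding ideal_adjoin_def by blast
      have "t * v * x = t * v * y + t * g * (u * v)" by (simp add: x algebra_simps)
      then show ?thesis using ideal_add[OF I ideal_mult[OF I x(2)] ideal_mult[OF I uv]] by simp
    qed
    moreover have "s * u * x \<in> I" if x2: "x \<in> ?I2" for x
    proof -
      obtain y g where x: "x = y + g * v" "y \<in> I" using x2 unfolding ideal_adjoin_def by blast
      have "s * u * x = s * u * y + s * g * (u * v)" by (simp add: x algebra_simps)
      then show ?thesis using ideal_add[OF I ideal_mult[OF I x(2)] ideal_mult[OF I uv]] by simp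
    qed
    ultimately show ?thesis
      by (intro stable_division_comaximal[OF I sub st])
  qed
qed

theorem theorem2p7:
  fixes I :: "'n::finite mpoly set"
  assumes "is_ideal I"
    and "zero_dimensional I"
  shows "stable_division_property h2_norm I"
proof -
  have "\<exists>R k. \<forall>i. finite (R i) \<and> (\<Prod>c\<in>R i. (Var i - Cst c) ^ k i) \<in> I"
    using zero_dimensional_prod_linear[OF assms] by metis
  then obtain R k where R: "\<And>i. finite (R i)" "\<And>i. (\<Prod>c\<in>R i. (Var i - Cst c) ^ k i) \<in> I"
    by blast
  show ?thesis
  proof (rule stable_division_prod_linear[OF assms(1) R(1)])
    fix i
    \<comment> \<open>The exponents found may differ between the variables; their sum is a common
      one.\<close>
    have "k i \<le> (\<Sum>i\<in>UNIV. k i)" by (rule member_le_sum) auto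
    with R(2)[of i] show "(\<Prod>c\<in>R i. (Var i - Cst c) ^ (\<Sum>i\<in>UNIV. k i)) \<in> I"
      unfolding prod_power_distrib[symmetric] by (rule ideal_power_mono[OF assms(1)])
  qed
qed

end
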